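(* Let $\delta,\epsilon\in\{1,-1\}$ and $r,s\in\{0,1\}$ be fixed constants with $r\le s$ such that $\delta=(-1)^{s+1}$ (so $s=1$ if $\delta=1$, and $s=0$ if $\delta=-1$) and $\epsilon=1$ if $\delta=-1$ ($\epsilon=\pm1$ being allowed if $\delta=1$). Let $\tau\in\{1,-1\}$. Let $\alpha(x_1,x_2)$ be a solution of $$\alpha_{x_1x_1}-\alpha_{x_2x_2}=-\epsilon\delta\, S_{(-1)^r}(\alpha),\qquad (\ast)$$ and let $\alpha'$ (resp. $\alpha''$) be a solution of $(\ast)$ associated to $\alpha$ by the $\phi_1$- (resp. $\phi_2$-) B\"acklund transformation defined in the context. If $\phi_1\ne\phi_2$, then there exists a unique solution $\alpha^*$ of $(\ast)$ such that $\alpha^*$ is associated to $\alpha'$ (resp. $\alpha''$) by the $\phi_2$- (resp. $\phi_1$-) B\"acklund transformation. Moreover, $\alpha^*$ is given algebraically by $$T_{(-1)^r}\Bigl(\frac{\alpha^*-\alpha}{4}\Bigr)=\delta\tau\,\frac{S_{-\delta\epsilon}\bigl(\frac{\phi_2+\phi_1}{2}\bigr)}{S_{-\delta\epsilon}\bigl(\frac{\phi_2-\phi_1}{2}\bigr)}\;T_{(-1)^r}\Bigl(\frac{\alpha'-\alpha''}{4}\Bigr),$$ where $T_{(-1)^r}$ is the function $\tan$ when $r=0$ and $\tanh$ when $r=1$.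
   Context: For $\xi\in\{1,-1\}$: $C_1=\cos$, $S_1=\sin$, $C_{-1}=\cosh$, $S_{-1}=\sinh$. Subscripts $x_i$ denote partial derivatives. With $\delta,\epsilon,r,s,\tau$ fixed, the parameters $\phi$ (in particular $\phi_1,\phi_2$) are constants in $(0,\pi)$ if $\epsilon(-1)^s=1$ and in $(0,\infty)$ if $\epsilon(-1)^s=-1$. For such $\phi$ put $\lambda=S_{-\epsilon\delta}(\phi)$ and $\Lambda=C_{-\epsilon\delta}(\phi)$. A function $\beta'$ is said to be associated to $\beta$ by the $\phi$-B\"acklund transformation if $$\beta'_{x_1}+\beta_{x_2}=\frac{2}{\lambda}S_{(-1)^r}\Bigl(\frac{\beta'}{2}\Bigr)C_{(-1)^r}\Bigl(\frac{\beta}{2}\Bigr)-\frac{2(-1)^s\tau\Lambda}{\lambda}C_{(-1)^r}\Bigl(\frac{\beta'}{2}\Bigr)S_{(-1)^r}\Bigl(\frac{\beta}{2}\Bigr),$$ $$\beta'_{x_2}+\beta_{x_1}=-\frac{2}{\lambda}C_{(-1)^r}\Bigl(\frac{\beta'}{2}\Bigr)S_{(-1)^r}\Bigl(\frac{\beta}{2}\Bigr)-\frac{2\delta\tau\Lambda}{\lambda}S_{(-1)^r}\Bigl(\frac{\beta'}{2}\Bigr)C_{(-1)^r}\Bigl(\frac{\beta}{2}\Bigr).$$ The same $\tau$ is used in all the transformations.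
   Formalization: α* is shown to exist where the right-hand side of the formula lies in the range of T (everywhere if r=0). If r=0, α* is unique on connected open sets only up to adding 4πn, except for the reflected solutions 2πk−α that occur when α''=2πl−α' with k−l odd. *)

theory Defs
  imports "HOL-Analysis.Analysis"
begin

text \<open>The functions \<open>C\<^sub>\<xi>\<close>, \<open>S\<^sub>\<xi>\<close>, \<open>T\<^sub>\<xi>\<close>, meant for \<open>\<xi> = 1\<close> (trigonometric) and \<open>\<xi> = -1\<close> (hyperbolic).\<close>

definition Cf :: "int \<Rightarrow> real \<Rightarrow> real" where
  "Cf \<xi> = (if \<xi> = 1 then cos else cosh)"

definition Sf :: "int \<Rightarrow> real \<Rightarrow> real" where
  "Sf \<xi> = (if \<xi> = 1 then sin else sinh)"

definition Tf :: "int \<Rightarrow> real \<Rightarrow> real" where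
  "Tf \<xi> = (if \<xi> = 1 then tan else tanh)"

definition pd1 :: "(real \<times> real \<Rightarrow> real) \<Rightarrow> real \<times> real \<Rightarrow> real" where
  "pd1 f p = deriv (\<lambda>t. f (t, snd p)) (fst p)"

definition pd2 :: "(real \<times> real \<Rightarrow> real) \<Rightarrow> real \<times> real \<Rightarrow> real" where
  "pd2 f p = deriv (\<lambda>t. f (fst p, t)) (snd p)"

definition C1_on :: "(real \<times> real) set \<Rightarrow> (real \<times> real \<Rightarrow> real) \<Rightarrow> bool" where
  "C1_on U f \<longleftrightarrow> (\<forall>p\<in>U. f differentiable (at p)) \<and> continuous_on U (pd1 f) \<and> continuous_on U (pd2 f)"

definition C2_on :: "(real \<times> real) set \<Rightarrow> (real \<times> real \<Rightarrow> real) \<Rightarrow> bool" where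
  "C2_on U f \<longleftrightarrow> C1_on U f \<and> C1_on U (pd1 f) \<and> C1_on U (pd2 f)"

text \<open>Classical (\<open>C\<^sup>2\<close>) solutions on an open set \<open>U\<close> of
  \<open>\<alpha>\<^bsub>x1x1\<^esub> - \<alpha>\<^bsub>x2x2\<^esub> = -\<epsilon>\<delta> S(\<alpha>)\<close>; values outside \<open>U\<close> are irrelevant.\<close>

definition solution_on ::
    "int \<Rightarrow> int \<Rightarrow> nat \<Rightarrow> (real \<times> real) set \<Rightarrow> (real \<times> real \<Rightarrow> real) \<Rightarrow> bool" where
  "solution_on \<delta> \<epsilon> r U \<alpha> \<longleftrightarrow> C2_on U \<alpha> \<and>
     (\<forall>p\<in>U. pd1 (pd1 \<alpha>) p - pd2 (pd2 \<alpha>) p = - of_int (\<epsilon> * \<delta>) * Sf ((-1) ^ r) (\<alpha> p))"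

definition parameter_range :: "int \<Rightarrow> nat \<Rightarrow> real set" where
  "parameter_range \<epsilon> s = (if \<epsilon> * (-1) ^ s = 1 then {0<..<pi} else {0<..})"

text \<open>\<open>backlund \<delta> \<epsilon> \<tau> r s \<phi> U \<beta> \<beta>'\<close>: on \<open>U\<close>, the function \<open>\<beta>'\<close> is associated to \<open>\<beta>\<close> by the
  \<open>\<phi>\<close>-Baecklund transformation.\<close>

definition backlund ::
    "int \<Rightarrow> int \<Rightarrow> int \<Rightarrow> nat \<Rightarrow> nat \<Rightarrow> real \<Rightarrow> (real \<times> real) set \<Rightarrow>
     (real \<times> real \<Rightarrow> real) \<Rightarrow> (real \<times> real \<Rightarrow> real) \<Rightarrow> bool" where
  "backlund \<delta> \<epsilon> \<tau> r s \<phi> U \<beta> \<beta>' \<longleftrightarrow>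
     (let l = Sf (- \<epsilon> * \<delta>) \<phi>; L = Cf (- \<epsilon> * \<delta>) \<phi>;
          S = Sf ((-1) ^ r); C = Cf ((-1) ^ r) in
      \<forall>p\<in>U.
        pd1 \<beta>' p + pd2 \<beta> p =
          2 / l * S (\<beta>' p / 2) * C (\<beta> p / 2)
          - 2 * (-1) ^ s * of_int \<tau> * L / l * C (\<beta>' p / 2) * S (\<beta> p / 2) \<and>
        pd2 \<beta>' p + pd1 \<beta> p =
          - (2 / l) * C (\<beta>' p / 2) * S (\<beta> p / 2)
          - 2 * of_int \<delta> * of_int \<tau> * L / l * S (\<beta>' p / 2) * C (\<beta> p / 2))"

definition superposition_coeff :: "int \<Rightarrow> int \<Rightarrow> int \<Rightarrow> real \<Rightarrow> real \<Rightarrow> real" where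
  "superposition_coeff \<delta> \<epsilon> \<tau> \<phi>1 \<phi>2 =
     of_int \<delta> * of_int \<tau> *
       (Sf (- \<delta> * \<epsilon>) ((\<phi>2 + \<phi>1) / 2) / Sf (- \<delta> * \<epsilon>) ((\<phi>2 - \<phi>1) / 2))"

text \<open>The points of \<open>U\<close> at which \<open>T(y) = c T((\<alpha>' - \<alpha>'') / 4)\<close> can be solved for \<open>y\<close>.
  For \<open>r = 0\<close> this is all of \<open>U\<close>; for \<open>r = 1\<close> it is the set where the right-hand side lies in \<open>(-1, 1)\<close>.\<close>

definition superposition_domain ::
    "nat \<Rightarrow> real \<Rightarrow> (real \<times> real) set \<Rightarrow>
     (real \<times> real \<Rightarrow> real) \<Rightarrow> (real \<times> real \<Rightarrow> real) \<Rightarrow> (real \<times> real) set" where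
  "superposition_domain r c U \<alpha>' \<alpha>'' =
     {p \<in> U. c * Tf ((-1) ^ r) ((\<alpha>' p - \<alpha>'' p) / 4) \<in> range (Tf ((-1) ^ r))}"

text \<open>The superposition formula \<open>T((\<alpha>\<^sup>* - \<alpha>) / 4) = c T((\<alpha>' - \<alpha>'') / 4)\<close> at every point of \<open>U\<close>.
  In HOL \<open>tan\<close> is \<open>0\<close> at its poles, so the equation alone would not distinguish poles from zeros;
  the second conjunct says that the two sides are infinite at the same points.\<close>

definition superposition_formula ::
    "nat \<Rightarrow> real \<Rightarrow> (real \<times> real) set \<Rightarrow> (real \<times> real \<Rightarrow> real) \<Rightarrow>
     (real \<times> real \<Rightarrow> real) \<Rightarrow> (real \<times> real \<Rightarrow> real) \<Rightarrow> (real \<times> real \<Rightarrow> real) \<Rightarrow> bool" where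
  "superposition_formula r c U \<alpha> \<alpha>' \<alpha>'' \<alpha>s \<longleftrightarrow>
     (\<forall>p\<in>U.
        Tf ((-1) ^ r) ((\<alpha>s p - \<alpha> p) / 4) = c * Tf ((-1) ^ r) ((\<alpha>' p - \<alpha>'' p) / 4) \<and>
        (r = 0 \<longrightarrow> (cos ((\<alpha>s p - \<alpha> p) / 4) = 0 \<longleftrightarrow> cos ((\<alpha>' p - \<alpha>'' p) / 4) = 0)))"

text \<open>For \<open>r = 0\<close> the sine and cosine of \<open>\<beta> / 2\<close> do not change under \<open>\<beta> \<mapsto> \<beta> + 4\<pi>\<close>, so solutions of
  the transformation equations can only be unique up to a multiple of \<open>4\<pi>\<close>; for \<open>r = 1\<close> there is no
  such period.\<close>

definition equal_up_to_period ::
    "nat \<Rightarrow> (real \<times> real) set \<Rightarrow> (real \<times> real \<Rightarrow> real) \<Rightarrow> (real \<times> real \<Rightarrow> real) \<Rightarrow> bool" where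
  "equal_up_to_period r V \<beta> \<gamma> \<longleftrightarrow>
     (if r = 0 then \<exists>n::int. \<forall>p\<in>V. \<beta> p = \<gamma> p + 4 * pi * of_int n else \<forall>p\<in>V. \<beta> p = \<gamma> p)"

text \<open>A degenerate configuration, possible only for \<open>r = 0\<close>. Subtracting the transformation
  equations gives the superposition formula only after cancelling
  \<open>cos ((\<alpha>' + \<alpha>'' - \<alpha> - \<beta>) / 4)\<close> and \<open>cos ((\<alpha>' + \<alpha>'' + \<alpha> + \<beta>) / 4)\<close>. If \<open>\<alpha>'' = 2\<pi>l - \<alpha>'\<close>, then
  \<open>\<beta> = 2\<pi>k - \<alpha>\<close> with \<open>k - l\<close> odd makes both factors vanish and satisfies all four equations
  (for instance \<open>\<alpha> = \<alpha>' = \<alpha>'' = 0\<close> and \<open>\<beta> = 2\<pi>\<close>).\<close>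

definition reflected_on ::
    "(real \<times> real) set \<Rightarrow> (real \<times> real \<Rightarrow> real) \<Rightarrow> (real \<times> real \<Rightarrow> real) \<Rightarrow>
     (real \<times> real \<Rightarrow> real) \<Rightarrow> (real \<times> real \<Rightarrow> real) \<Rightarrow> bool" where
  "reflected_on V \<alpha> \<alpha>' \<alpha>'' \<beta> \<longleftrightarrow>
     (\<exists>k l::int. odd (k - l) \<and>
        (\<forall>p\<in>V. \<beta> p = 2 * pi * of_int k - \<alpha> p \<and> \<alpha>'' p = 2 * pi * of_int l - \<alpha>' p))"

end

theory Submission imports Defs begin

text \<open>
  Put \<open>\<kappa> = (-1)^r\<close>, \<open>\<xi> = - \<epsilon> \<delta>\<close>, \<open>\<sigma> = \<delta> \<tau>\<close>, and write \<open>D+\<close> and \<open>D-\<close> for the sum and the difference of the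
  two partial derivatives. Since \<open>(-1)^s = - \<delta>\<close>, adding and subtracting the two equations of the
  \<open>\<phi>\<close>-transformation turns them into
  \<open>D+(\<beta>' + \<beta>) = 2 a S((\<beta>' - \<beta>) / 2)\<close> and \<open>D-(\<beta>' - \<beta>) = 2 b S((\<beta>' + \<beta>) / 2)\<close>
  with \<open>a = (1 - \<sigma> \<Lambda>) / \<lambda>\<close> and \<open>b = (1 + \<sigma> \<Lambda>) / \<lambda>\<close>. The identity \<open>\<Lambda>^2 + \<xi> \<lambda>^2 = 1\<close> gives \<open>a b = \<xi>\<close>, so
  the whole family depends on the single number \<open>a\<close>, and half-angle formulas turn the superposition
  coefficient \<open>c\<close> into the solution of \<open>c (a2 - a1) = a1 + a2\<close>.

  Let \<open>\<beta>\<close> close the quadrilateral, put \<open>Y = (\<beta> - \<alpha>) / 4\<close> and \<open>u = (\<alpha>' - \<alpha>'') / 4\<close>. The alternating sum of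
  the four \<open>D+\<close> equations has no derivatives left, and likewise for \<open>D-\<close>; sum-to-product formulas give
  \<open>F C(A) = 0 = F C(B)\<close> with the common factor \<open>F = a1 S(Y + u) - a2 S(Y - u)\<close>, where
  \<open>A = (\<alpha>' + \<alpha>'' - \<alpha> - \<beta>) / 4\<close> and \<open>B = (\<alpha>' + \<alpha>'' + \<alpha> + \<beta>) / 4\<close> (\<open>quadrilateral_factorization\<close>).
  Vanishing of \<open>F\<close> is equivalent to \<open>S(Y) C(u) = c C(Y) S(u)\<close>, the superposition formula
  without denominators.

  Uniqueness. At a point where \<open>F\<close> is nonzero both cosines vanish nearby, so \<open>\<alpha> + \<beta>\<close>
  and \<open>\<alpha>' + \<alpha>''\<close> are locally constant there, and then the transformation equations make \<open>F\<close> a first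
  integral. Hence \<open>F^2\<close> has zero derivative everywhere and is constant on a connected set
  (\<open>quadrilateral_dichotomy\<close>): either \<open>F\<close> vanishes identically, which determines \<open>\<beta>\<close> up to the period,
  or both cosines vanish identically, which is the reflected configuration.

  Existence. The equation \<open>S(G u) C(u) = c C(G u) S(u)\<close> has a solution \<open>G\<close> with derivative
  \<open>c / (C^2 + \<kappa> c^2 S^2)\<close>, smooth across the poles of the tangent when \<open>r = 0\<close> (\<open>superposition_lift\<close>). So
  \<open>\<alpha>s = \<alpha> + 4 G(u)\<close> is a \<open>C\<^sup>1\<close> function on the superposition domain, and the transformation
  equations for it reduce to the algebraic identity \<open>superposition_identity\<close>. They express the first derivatives of \<open>\<alpha>s\<close> by \<open>C\<^sup>1\<close> functions, so \<open>\<alpha>s\<close> is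
  \<open>C\<^sup>2\<close>. Differentiating them once more gives the wave equation for \<open>\<alpha>s\<close> up to the commutator of
  the mixed derivatives of \<open>\<alpha>'\<close> (\<open>wave_commutator\<close>), and that commutator is zero because \<open>\<alpha>\<close>, which is
  also linked to \<open>\<alpha>'\<close>, satisfies the wave equation.
\<close>

section \<open>The trigonometric and hyperbolic functions treated together\<close>

lemma Sf_plus:
  assumes "\<kappa> = 1 \<or> \<kappa> = -1"
  shows "Sf \<kappa> (x + y) = Sf \<kappa> x * Cf \<kappa> y + Cf \<kappa> x * Sf \<kappa> y"
  using assms by (auto simp: Sf_def Cf_def sin_add sinh_add)

lemma Cf_plus:
  assumes "\<kappa> = 1 \<or> \<kappa> = -1"
  shows "Cf \<kappa> (x + y) = Cf \<kappa> x * Cf \<kappa> y - of_int \<kappa> * (Sf \<kappa> x * Sf \<kappa> y)"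
  using assms by (auto simp: Sf_def Cf_def cos_add cosh_add)

lemma Sf_minus [simp]: "Sf \<kappa> (- x) = - Sf \<kappa> x"
  and Cf_minus [simp]: "Cf \<kappa> (- x) = Cf \<kappa> x"
  by (simp_all add: Sf_def Cf_def)

lemma Cf_square:
  assumes "\<kappa> = 1 \<or> \<kappa> = -1"
  shows "(Cf \<kappa> x)\<^sup>2 = 1 - of_int \<kappa> * (Sf \<kappa> x)\<^sup>2"
  using assms by (auto simp: Sf_def Cf_def cos_squared_eq cosh_square_eq)

lemma Sf_diff:
  assumes "\<kappa> = 1 \<or> \<kappa> = -1"
  shows "Sf \<kappa> (x - y) = Sf \<kappa> x * Cf \<kappa> y - Cf \<kappa> x * Sf \<kappa> y"
  using Sf_plus[OF assms, of x "- y"] by simp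

lemma Sf_pos:
  assumes "0 < x" "\<xi> = 1 \<Longrightarrow> x < pi"
  shows "Sf \<xi> x > 0"
  using assms sin_gt_zero[of x] by (simp add: Sf_def)

lemma Cf_pos:
  assumes "0 < x" "\<xi> = 1 \<Longrightarrow> x < pi / 2"
  shows "Cf \<xi> x > 0"
  using assms cos_gt_zero[of x] by (simp add: Cf_def cosh_real_pos)

lemma Sf_has_derivative: "(Sf \<kappa> has_real_derivative Cf \<kappa> x) (at x)"
  by (cases "\<kappa> = 1") (auto simp: Sf_def Cf_def intro!: derivative_eq_intros)

lemma Cf_has_derivative:
  assumes "\<kappa> = 1 \<or> \<kappa> = -1"
  shows "(Cf \<kappa> has_real_derivative - of_int \<kappa> * Sf \<kappa> x) (at x)"
  using assms by (auto simp: Sf_def Cf_def intro!: derivative_eq_intros)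

lemma continuous_on_Sf: "continuous_on A f \<Longrightarrow> continuous_on A (\<lambda>x. Sf \<kappa> (f x))"
  by (rule continuous_on_compose2[of UNIV "Sf \<kappa>"])
    (auto intro: continuous_at_imp_continuous_on DERIV_isCont Sf_has_derivative)

lemma continuous_on_Cf:
  assumes "\<kappa> = 1 \<or> \<kappa> = -1" "continuous_on A f"
  shows "continuous_on A (\<lambda>x. Cf \<kappa> (f x))"
  using assms(2)
  by (rule continuous_on_compose2[of UNIV "Cf \<kappa>", rotated])
    (auto intro!: continuous_at_imp_continuous_on DERIV_isCont Cf_has_derivative assms(1))

section \<open>Partial derivatives and continuously differentiable functions\<close>

text \<open>A gradient is recorded as a Frechet derivative with named components: this is the form in which
  sums and compositions can be differentiated, while \<open>pd1\<close> and \<open>pd2\<close> only see the coordinate lines.\<close>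

definition has_grad :: "(real \<times> real \<Rightarrow> real) \<Rightarrow> real \<Rightarrow> real \<Rightarrow> real \<times> real \<Rightarrow> bool" where
  "has_grad f a b p \<longleftrightarrow> (f has_derivative (\<lambda>v. a * fst v + b * snd v)) (at p)"

lemma has_grad_imp_pd:
  assumes "has_grad f a b p"
  shows "pd1 f p = a" "pd2 f p = b"
proof -
  obtain x y where p: "p = (x, y)" by (cases p)
  have D: "(f has_derivative (\<lambda>v. a * fst v + b * snd v)) (at (x, y))"
    using assms by (simp add: has_grad_def p)
  have "((\<lambda>t. f (t, y)) has_derivative (\<lambda>h. a * fst (h, 0::real) + b * snd (h, 0::real))) (at x)"
    by (rule has_derivative_compose[of "\<lambda>t. (t, y)" _ _ _ f, OF _ D])
      (auto intro!: derivative_eq_intros)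
  then have "((\<lambda>t. f (t, y)) has_real_derivative a) (at x)"
    by (simp add: has_field_derivative_def)
  then show "pd1 f p = a" by (simp add: pd1_def p DERIV_imp_deriv)
  have "((\<lambda>t. f (x, t)) has_derivative (\<lambda>h. a * fst (0::real, h) + b * snd (0::real, h))) (at y)"
    by (rule has_derivative_compose[of "\<lambda>t. (x, t)" _ _ _ f, OF _ D])
      (auto intro!: derivative_eq_intros)
  then have "((\<lambda>t. f (x, t)) has_real_derivative b) (at y)"
    by (simp add: has_field_derivative_def)
  then show "pd2 f p = b" by (simp add: pd2_def p DERIV_imp_deriv)
qed

lemma differentiable_imp_has_grad:
  assumes "f differentiable (at p)"
  shows "has_grad f (pd1 f p) (pd2 f p) p"
proof -
  obtain f' where f': "(f has_derivative f') (at p)"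
    using assms by (auto simp: differentiable_def)
  have lin: "linear f'" using f' has_derivative_linear by blast
  have "f' = (\<lambda>v. f' (1, 0) * fst v + f' (0, 1) * snd v)"
  proof
    fix v :: "real \<times> real"
    have "f' v = f' (fst v *\<^sub>R (1, 0) + snd v *\<^sub>R (0, 1))" by simp
    also have "\<dots> = fst v *\<^sub>R f' (1, 0) + snd v *\<^sub>R f' (0, 1)"
      by (simp only: linear_add[OF lin] linear_cmul[OF lin])
    finally show "f' v = f' (1, 0) * fst v + f' (0, 1) * snd v"
      by (simp add: mult.commute)
  qed
  then have "has_grad f (f' (1, 0)) (f' (0, 1)) p"
    using f' by (simp add: has_grad_def)
  then show ?thesis using has_grad_imp_pd by metis
qed

text \<open>Partial derivatives at a point of an open set depend only on the values in that set; this is what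
  permits differentiating equations that hold on \<open>V\<close> alone.\<close>

lemma has_grad_cong:
  assumes "open V" "p \<in> V" "\<And>q. q \<in> V \<Longrightarrow> f q = g q" "has_grad f a b p"
  shows "has_grad g a b p"
  using has_derivative_transform_within_open[OF _ assms(1,2), of f _ UNIV g] assms(3,4)
  by (simp add: has_grad_def)

lemma has_grad_const: "has_grad (\<lambda>q. k) 0 0 p"
  by (simp add: has_grad_def)

lemma has_grad_add:
  assumes "has_grad f a b p" "has_grad g c d p"
  shows "has_grad (\<lambda>q. f q + g q) (a + c) (b + d) p"
  using assms unfolding has_grad_def
  by (auto intro!: derivative_eq_intros simp: algebra_simps)

lemma has_grad_cmult:
  assumes "has_grad f a b p"
  shows "has_grad (\<lambda>q. k * f q) (k * a) (k * b) p"
  using assms unfolding has_grad_def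
  by (auto intro!: derivative_eq_intros simp: algebra_simps)

lemma has_grad_diff:
  assumes "has_grad f a b p" "has_grad g c d p"
  shows "has_grad (\<lambda>q. f q - g q) (a - c) (b - d) p"
  using has_grad_add[OF assms(1) has_grad_cmult[OF assms(2), of "-1"]] by simp

lemma has_grad_chain:
  assumes "has_grad f a b p" "(h has_real_derivative m) (at (f p))"
  shows "has_grad (\<lambda>q. h (f q)) (m * a) (m * b) p"
proof -
  have "((\<lambda>q. h (f q)) has_derivative (\<lambda>v. m * (a * fst v + b * snd v))) (at p)"
    using assms has_derivative_compose[of f _ p UNIV h "(*) m"]
    by (simp add: has_grad_def has_field_derivative_def)
  then show ?thesis by (simp add: has_grad_def distrib_left mult.assoc)
qed

lemma C1_on_imp_has_grad:
  "C1_on V f \<Longrightarrow> p \<in> V \<Longrightarrow> has_grad f (pd1 f p) (pd2 f p) p"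
  by (auto simp: C1_on_def intro: differentiable_imp_has_grad)

lemma C1_on_imp_continuous_on:
  assumes "C1_on V f" shows "continuous_on V f"
  using assms unfolding C1_on_def
  by (meson continuous_at_imp_continuous_on differentiable_imp_continuous_within)

lemma C1_onI:
  assumes "\<And>p. p \<in> V \<Longrightarrow> has_grad f (a p) (b p) p" "continuous_on V a" "continuous_on V b"
  shows "C1_on V f"
proof -
  have "continuous_on V (pd1 f)"
    using assms(2) by (rule continuous_on_eq) (use assms(1) has_grad_imp_pd in force)
  moreover have "continuous_on V (pd2 f)"
    using assms(3) by (rule continuous_on_eq) (use assms(1) has_grad_imp_pd in force)
  ultimately show ?thesis
    using assms(1) unfolding C1_on_def has_grad_def differentiable_def by blast
qed

lemma C1_on_cong:
  assumes "open V" "\<And>q. q \<in> V \<Longrightarrow> f q = g q" "C1_on V f"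
  shows "C1_on V g"
proof (rule C1_onI[of V g "pd1 f" "pd2 f"])
  show "has_grad g (pd1 f p) (pd2 f p) p" if "p \<in> V" for p
    using has_grad_cong[OF assms(1) that assms(2) C1_on_imp_has_grad[OF assms(3) that]] .
qed (use assms(3) in \<open>auto simp: C1_on_def\<close>)

lemma C1_on_add:
  assumes "C1_on V f" "C1_on V g"
  shows "C1_on V (\<lambda>q. f q + g q)"
proof (rule C1_onI)
  show "has_grad (\<lambda>q. f q + g q) (pd1 f p + pd1 g p) (pd2 f p + pd2 g p) p" if "p \<in> V" for p
    using assms that by (intro has_grad_add C1_on_imp_has_grad)
qed (use assms in \<open>auto simp: C1_on_def intro!: continuous_on_add\<close>)

lemma C1_on_cmult:
  assumes "C1_on V f"
  shows "C1_on V (\<lambda>q. k * f q)"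
proof (rule C1_onI)
  show "has_grad (\<lambda>q. k * f q) (k * pd1 f p) (k * pd2 f p) p" if "p \<in> V" for p
    using assms that by (intro has_grad_cmult C1_on_imp_has_grad)
qed (use assms in \<open>auto simp: C1_on_def intro!: continuous_on_mult continuous_on_const\<close>)

lemma C1_on_diff:
  assumes "C1_on V f" "C1_on V g"
  shows "C1_on V (\<lambda>q. f q - g q)"
  using C1_on_add[OF assms(1) C1_on_cmult[OF assms(2), of "-1"]] by simp

lemma C1_on_chain:
  assumes "C1_on V f" "\<And>p. p \<in> V \<Longrightarrow> (h has_real_derivative h' (f p)) (at (f p))"
    and "continuous_on (f ` V) h'"
  shows "C1_on V (\<lambda>q. h (f q))"
proof (rule C1_onI)
  show "has_grad (\<lambda>q. h (f q)) (h' (f p) * pd1 f p) (h' (f p) * pd2 f p) p" if "p \<in> V" for p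
    using assms(1,2) that by (intro has_grad_chain C1_on_imp_has_grad)
  have "continuous_on V (\<lambda>p. h' (f p))"
    using continuous_on_compose[OF C1_on_imp_continuous_on[OF assms(1)] assms(3)]
    by (simp add: o_def)
  then show "continuous_on V (\<lambda>p. h' (f p) * pd1 f p)" "continuous_on V (\<lambda>p. h' (f p) * pd2 f p)"
    using assms(1) by (simp_all add: C1_on_def continuous_on_mult)
qed

lemma C1_on_Sf:
  assumes "\<kappa> = 1 \<or> \<kappa> = -1" "C1_on V f"
  shows "C1_on V (\<lambda>q. Sf \<kappa> (f q))"
  using assms(2) Sf_has_derivative
  by (rule C1_on_chain[where h' = "Cf \<kappa>"]) (rule continuous_on_Cf[OF assms(1) continuous_on_id])

lemma C2_on_imp_C1_on:
  assumes "C2_on V f"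
  shows "C1_on V f" "C1_on V (pd1 f)" "C1_on V (pd2 f)"
  using assms by (auto simp: C2_on_def)

lemma C1_on_subset: "C1_on U f \<Longrightarrow> V \<subseteq> U \<Longrightarrow> C1_on V f"
  by (auto simp: C1_on_def intro: continuous_on_subset)

lemma C2_on_subset: "C2_on U f \<Longrightarrow> V \<subseteq> U \<Longrightarrow> C2_on V f"
  by (auto simp: C2_on_def intro: C1_on_subset)

section \<open>The transformation in a one-parameter form\<close>

text \<open>The transformation equations at one point after product-to-sum formulas; \<open>a\<close> and \<open>b\<close> are the
  coefficients of the two characteristic directions.\<close>

definition bt_at :: "int \<Rightarrow> real \<Rightarrow> real \<Rightarrow> (real \<times> real \<Rightarrow> real) \<Rightarrow> (real \<times> real \<Rightarrow> real)
    \<Rightarrow> real \<times> real \<Rightarrow> bool" where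
  "bt_at \<kappa> a b \<beta> \<beta>' p \<longleftrightarrow>
     pd1 \<beta>' p + pd2 \<beta> p = a * Sf \<kappa> ((\<beta>' p - \<beta> p) / 2) + b * Sf \<kappa> ((\<beta>' p + \<beta> p) / 2) \<and>
     pd2 \<beta>' p + pd1 \<beta> p = a * Sf \<kappa> ((\<beta>' p - \<beta> p) / 2) - b * Sf \<kappa> ((\<beta>' p + \<beta> p) / 2)"

text \<open>The coefficient \<open>a\<close> belonging to the angle \<open>\<phi>\<close>. Replacing \<open>\<sigma>\<close> by \<open>- \<sigma>\<close> gives \<open>b\<close>.\<close>

definition bt_speed :: "int \<Rightarrow> real \<Rightarrow> real \<Rightarrow> real" where
  "bt_speed \<xi> \<sigma> \<phi> = (1 - \<sigma> * Cf \<xi> \<phi>) / Sf \<xi> \<phi>"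

text \<open>Sum and difference of the two equations: each of the two right-hand sides becomes a single term.\<close>

lemma bt_at_iff_characteristic:
  "bt_at \<kappa> a b \<beta> \<beta>' p \<longleftrightarrow>
     (pd1 \<beta>' p + pd2 \<beta>' p) + (pd1 \<beta> p + pd2 \<beta> p) = 2 * a * Sf \<kappa> ((\<beta>' p - \<beta> p) / 2) \<and>
     (pd1 \<beta>' p - pd2 \<beta>' p) - (pd1 \<beta> p - pd2 \<beta> p) = 2 * b * Sf \<kappa> ((\<beta>' p + \<beta> p) / 2)"
  unfolding bt_at_def by auto

text \<open>The relation is symmetric up to the signs of \<open>a\<close> and \<open>b\<close>, which leave \<open>a * b\<close> unchanged. So
  whatever is derived for the second function also holds for the first.\<close>

lemma bt_at_sym: "bt_at \<kappa> a b \<beta> \<beta>' p \<longleftrightarrow> bt_at \<kappa> (- a) (- b) \<beta>' \<beta> p"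
proof -
  have "Sf \<kappa> ((\<beta> p - \<beta>' p) / 2) = - Sf \<kappa> ((\<beta>' p - \<beta> p) / 2)"
    using Sf_minus[of \<kappa> "(\<beta>' p - \<beta> p) / 2"] by (simp add: minus_divide_left)
  then show ?thesis by (auto simp: bt_at_def add.commute)
qed

text \<open>The relation between \<open>\<delta>\<close> and \<open>s\<close> makes \<open>(-1) ^ s\<close> equal to \<open>- \<delta>\<close>, so that the cross terms of the two
  equations carry the same coefficient up to sign.\<close>

lemma backlund_iff_bt_at:
  assumes "\<delta> = (-1) ^ (s + 1)" "s \<in> {0, 1}"
    and \<kappa>: "\<kappa> = 1 \<or> \<kappa> = -1" "\<kappa> = (-1) ^ r"
  shows "backlund \<delta> \<epsilon> \<tau> r s \<phi> V \<beta> \<beta>' \<longleftrightarrow>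
    (\<forall>p\<in>V. bt_at \<kappa> (bt_speed (- \<epsilon> * \<delta>) (of_int (\<delta> * \<tau>)) \<phi>)
              (bt_speed (- \<epsilon> * \<delta>) (- of_int (\<delta> * \<tau>)) \<phi>) \<beta> \<beta>' p)"
proof -
  have s: "(-1::real) ^ s = - of_int \<delta>" using assms by auto
  have e: "backlund \<delta> \<epsilon> \<tau> r s \<phi> V \<beta> \<beta>' \<longleftrightarrow> (\<forall>p\<in>V.
      pd1 \<beta>' p + pd2 \<beta> p = (a + b) * Sf \<kappa> (\<beta>' p / 2) * Cf \<kappa> (\<beta> p / 2)
        + (b - a) * Cf \<kappa> (\<beta>' p / 2) * Sf \<kappa> (\<beta> p / 2) \<and>
      pd2 \<beta>' p + pd1 \<beta> p = - (a + b) * Cf \<kappa> (\<beta>' p / 2) * Sf \<kappa> (\<beta> p / 2)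
        - (b - a) * Sf \<kappa> (\<beta>' p / 2) * Cf \<kappa> (\<beta> p / 2))"
    if ab: "a = bt_speed (- \<epsilon> * \<delta>) (of_int (\<delta> * \<tau>)) \<phi>"
      "b = bt_speed (- \<epsilon> * \<delta>) (- of_int (\<delta> * \<tau>)) \<phi>" for a b
  proof -
    have "a + b = 2 / Sf (- \<epsilon> * \<delta>) \<phi>"
      and "b - a = 2 * of_int \<delta> * of_int \<tau> * Cf (- \<epsilon> * \<delta>) \<phi> / Sf (- \<epsilon> * \<delta>) \<phi>"
      unfolding ab bt_speed_def
      by (simp_all add: add_divide_distrib[symmetric] diff_divide_distrib[symmetric])
    then show ?thesis
      unfolding backlund_def Let_def s \<kappa>(2)[symmetric] by simp
  qed
  show ?thesis
    unfolding e[OF refl refl] bt_at_def add_divide_distrib diff_divide_distrib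
      Sf_plus[OF \<kappa>(1)] Sf_diff[OF \<kappa>(1)]
    by (simp only: algebra_simps mult_minus_left mult_minus_right minus_add_distrib
        add_uminus_conv_diff)
qed

text \<open>This is \<open>(1 - \<Lambda>^2) / \<lambda>^2 = \<xi>\<close>: the product of the two coefficients is the constant of the wave
  equation, for every angle.\<close>

lemma bt_speed_mult:
  assumes "\<xi> = 1 \<or> \<xi> = -1" "Sf \<xi> \<phi> \<noteq> 0" "\<sigma>\<^sup>2 = 1"
  shows "bt_speed \<xi> \<sigma> \<phi> * bt_speed \<xi> (- \<sigma>) \<phi> = of_int \<xi>"
proof -
  have "(1 - \<sigma> * Cf \<xi> \<phi>) * (1 + \<sigma> * Cf \<xi> \<phi>) = 1 - \<sigma>\<^sup>2 * (Cf \<xi> \<phi>)\<^sup>2"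
    by (simp add: algebra_simps power2_eq_square)
  also have "\<dots> = of_int \<xi> * (Sf \<xi> \<phi>)\<^sup>2"
    using assms by (simp add: Cf_square)
  finally show ?thesis
    using assms(2) by (simp add: bt_speed_def field_simps power2_eq_square)
qed

text \<open>The numerators \<open>1 - C(\<phi>)\<close> and \<open>1 + C(\<phi>)\<close> are \<open>2 \<xi> S(\<phi>/2)^2\<close> and \<open>2 C(\<phi>/2)^2\<close>.\<close>

lemma bt_speed_half:
  assumes \<xi>: "\<xi> = 1 \<or> \<xi> = -1" and "Sf \<xi> (\<phi>/2) \<noteq> 0" "Cf \<xi> (\<phi>/2) \<noteq> 0"
  shows "bt_speed \<xi> 1 \<phi> = of_int \<xi> * Sf \<xi> (\<phi>/2) / Cf \<xi> (\<phi>/2)"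
    and "bt_speed \<xi> (-1) \<phi> = Cf \<xi> (\<phi>/2) / Sf \<xi> (\<phi>/2)"
proof -
  have S: "Sf \<xi> \<phi> = 2 * Sf \<xi> (\<phi>/2) * Cf \<xi> (\<phi>/2)"
    using Sf_plus[OF \<xi>, of "\<phi>/2" "\<phi>/2"] by simp
  have C: "Cf \<xi> \<phi> = (Cf \<xi> (\<phi>/2))\<^sup>2 - of_int \<xi> * (Sf \<xi> (\<phi>/2))\<^sup>2"
    using Cf_plus[OF \<xi>, of "\<phi>/2" "\<phi>/2"] by (simp add: power2_eq_square)
  have "1 - Cf \<xi> \<phi> = 2 * of_int \<xi> * (Sf \<xi> (\<phi>/2))\<^sup>2" "1 + Cf \<xi> \<phi> = 2 * (Cf \<xi> (\<phi>/2))\<^sup>2"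
    using C Cf_square[OF \<xi>, of "\<phi>/2"] by auto
  then show "bt_speed \<xi> 1 \<phi> = of_int \<xi> * Sf \<xi> (\<phi>/2) / Cf \<xi> (\<phi>/2)"
    and "bt_speed \<xi> (-1) \<phi> = Cf \<xi> (\<phi>/2) / Sf \<xi> (\<phi>/2)"
    using assms(2,3) by (simp_all add: bt_speed_def S power2_eq_square)
qed

lemma parameter_range_bounds:
  assumes "\<phi> \<in> parameter_range \<epsilon> s" "\<xi> = \<epsilon> * (-1) ^ s"
  shows "0 < \<phi>" "\<xi> = 1 \<Longrightarrow> \<phi> < pi"
  using assms by (simp_all add: parameter_range_def split: if_splits)

lemma Sf_half_diff_nonzero:
  assumes "0 < x" "0 < y" "\<xi> = 1 \<Longrightarrow> x < pi" "\<xi> = 1 \<Longrightarrow> y < pi" "x \<noteq> y"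
  shows "Sf \<xi> ((y - x) / 2) \<noteq> 0"
proof (cases "x < y")
  case True
  have "Sf \<xi> ((y - x) / 2) > 0"
    using True assms(1) assms(4) by (intro Sf_pos) simp_all
  then show ?thesis by simp
next
  case False
  have "Sf \<xi> ((x - y) / 2) > 0"
    using False assms(2) assms(3) assms(5) by (intro Sf_pos) simp_all
  moreover have "Sf \<xi> ((y - x) / 2) = - Sf \<xi> ((x - y) / 2)"
    using Sf_minus[of \<xi> "(x - y) / 2"] by (simp add: minus_divide_left)
  ultimately show ?thesis by simp
qed

text \<open>This is how \<open>c\<close> enters all later computations. By the addition formulas the quotient in \<open>c\<close> is
  \<open>(T2 + T1) / (T2 - T1)\<close> with \<open>Ti = S(\<phi>i/2) / C(\<phi>i/2)\<close>. The coefficients of the two angles are \<open>\<xi> Ti\<close> for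
  \<open>\<sigma> = 1\<close> and \<open>1 / Ti\<close> for \<open>\<sigma> = -1\<close>; passing to reciprocals changes the sign of the quotient, and this is
  compensated by the factor \<open>\<delta> \<tau>\<close> in \<open>c\<close>.\<close>

lemma superposition_coeff_eq:
  assumes X: "X = - \<epsilon> * \<delta>" "X = 1 \<or> X = -1" and \<sigma>: "\<sigma> = \<delta> * \<tau>" "\<sigma> = 1 \<or> \<sigma> = -1"
    and pos: "Sf X (\<phi>1/2) \<noteq> 0" "Cf X (\<phi>1/2) \<noteq> 0" "Sf X (\<phi>2/2) \<noteq> 0" "Cf X (\<phi>2/2) \<noteq> 0"
    and dif: "Sf X ((\<phi>2 - \<phi>1)/2) \<noteq> 0"
  shows "superposition_coeff \<delta> \<epsilon> \<tau> \<phi>1 \<phi>2 * (bt_speed X (of_int \<sigma>) \<phi>2 - bt_speed X (of_int \<sigma>) \<phi>1)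
    = bt_speed X (of_int \<sigma>) \<phi>1 + bt_speed X (of_int \<sigma>) \<phi>2"
proof -
  have c: "superposition_coeff \<delta> \<epsilon> \<tau> \<phi>1 \<phi>2 * Sf X ((\<phi>2 - \<phi>1)/2) = of_int \<sigma> * Sf X ((\<phi>2 + \<phi>1)/2)"
    using dif X(1) \<sigma>(1) by (simp add: superposition_coeff_def mult.commute)
  define k where "k = superposition_coeff \<delta> \<epsilon> \<tau> \<phi>1 \<phi>2"
  have c': "k * (Sf X (\<phi>2/2) * Cf X (\<phi>1/2) - Cf X (\<phi>2/2) * Sf X (\<phi>1/2))
      = of_int \<sigma> * (Sf X (\<phi>2/2) * Cf X (\<phi>1/2) + Cf X (\<phi>2/2) * Sf X (\<phi>1/2))"
    using c by (simp add: diff_divide_distrib add_divide_distrib Sf_plus[OF X(2)] Sf_diff[OF X(2)] k_def)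
  show ?thesis
    using \<sigma>(2)
  proof
    assume s: "\<sigma> = 1"
    have "k * (Sf X (\<phi>2/2) / Cf X (\<phi>2/2) - Sf X (\<phi>1/2) / Cf X (\<phi>1/2))
      = Sf X (\<phi>1/2) / Cf X (\<phi>1/2) + Sf X (\<phi>2/2) / Cf X (\<phi>2/2)"
      using c' pos s by (simp add: field_simps)
    then have "of_int X * (k * (Sf X (\<phi>2/2) / Cf X (\<phi>2/2) - Sf X (\<phi>1/2) / Cf X (\<phi>1/2)))
      = of_int X * (Sf X (\<phi>1/2) / Cf X (\<phi>1/2) + Sf X (\<phi>2/2) / Cf X (\<phi>2/2))"
      by simp
    then show ?thesis
      by (simp add: s bt_speed_half[OF X(2)] pos k_def[symmetric] algebra_simps)
  next
    assume s: "\<sigma> = -1"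
    have "k * (Cf X (\<phi>2/2) / Sf X (\<phi>2/2) - Cf X (\<phi>1/2) / Sf X (\<phi>1/2))
      = Cf X (\<phi>1/2) / Sf X (\<phi>1/2) + Cf X (\<phi>2/2) / Sf X (\<phi>2/2)"
      using c' pos s by (simp add: field_simps)
    then show ?thesis
      by (simp add: s bt_speed_half[OF X(2)] pos k_def[symmetric])
  qed
qed

section \<open>Regularity and the wave equation along a transformation\<close>

lemma solution_on_iff:
  "solution_on \<delta> \<epsilon> r V \<beta> \<longleftrightarrow> C2_on V \<beta> \<and>
     (\<forall>p\<in>V. pd1 (pd1 \<beta>) p - pd2 (pd2 \<beta>) p = of_int (- \<epsilon> * \<delta>) * Sf ((-1) ^ r) (\<beta> p))"
  by (simp add: solution_on_def)

text \<open>Differentiating the first equation in \<open>x1\<close>, the second in \<open>x2\<close> and subtracting leaves, besides the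
  mixed derivatives of \<open>\<beta>\<close>, the terms \<open>C(X) (X1 - X2)\<close> and \<open>C(Z) (Z1 + Z2)\<close> with \<open>X = (\<beta>' - \<beta>) / 2\<close>,
  \<open>Z = (\<beta>' + \<beta>) / 2\<close>. The characteristic form of the equations replaces \<open>X1 - X2\<close> by \<open>b S(Z)\<close> and
  \<open>Z1 + Z2\<close> by \<open>a S(X)\<close>, and the addition formula produces \<open>S(X + Z) = S(\<beta>')\<close>. The
  commutator of the mixed derivatives stays explicit: once \<open>\<beta>'\<close> is known to satisfy the wave equation,
  the formula shows that the commutator of \<open>\<beta>\<close> is zero.\<close>

lemma wave_commutator:
  assumes \<kappa>: "\<kappa> = 1 \<or> \<kappa> = -1" and "open V" "p \<in> V" "C2_on V \<beta>" "C2_on V \<beta>'"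
    and bt: "\<And>q. q \<in> V \<Longrightarrow> bt_at \<kappa> a b \<beta> \<beta>' q"
  shows "pd1 (pd1 \<beta>') p - pd2 (pd2 \<beta>') p =
    a * b * Sf \<kappa> (\<beta>' p) - (pd1 (pd2 \<beta>) p - pd2 (pd1 \<beta>) p)"
proof -
  note g = C1_on_imp_has_grad[OF _ \<open>p \<in> V\<close>]
  note b = C2_on_imp_C1_on[OF assms(4)] and b' = C2_on_imp_C1_on[OF assms(5)]
  define X where "X = (\<lambda>q. (1/2) * (\<beta>' q - \<beta> q))"
  define Z where "Z = (\<lambda>q. (1/2) * (\<beta>' q + \<beta> q))"
  note gX = has_grad_chain[OF has_grad_cmult[OF has_grad_diff[OF g[OF b'(1)] g[OF b(1)]], of "1/2"]
      Sf_has_derivative, of \<kappa>, folded X_def[THEN fun_cong]]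
  note gZ = has_grad_chain[OF has_grad_cmult[OF has_grad_add[OF g[OF b'(1)] g[OF b(1)]], of "1/2"]
      Sf_has_derivative, of \<kappa>, folded Z_def[THEN fun_cong]]
  have 1: "pd1 \<beta>' q = (a * Sf \<kappa> (X q) + b * Sf \<kappa> (Z q)) - pd2 \<beta> q"
      and 2: "pd2 \<beta>' q = (a * Sf \<kappa> (X q) - b * Sf \<kappa> (Z q)) - pd1 \<beta> q" if "q \<in> V" for q
    using bt[OF that] by (auto simp: bt_at_def X_def Z_def)
  have e1: "pd1 (pd1 \<beta>') p = (a * (Cf \<kappa> (X p) * (1/2 * (pd1 \<beta>' p - pd1 \<beta> p)))
      + b * (Cf \<kappa> (Z p) * (1/2 * (pd1 \<beta>' p + pd1 \<beta> p)))) - pd1 (pd2 \<beta>) p"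
    by (rule has_grad_imp_pd(1), rule has_grad_cong[OF \<open>open V\<close> \<open>p \<in> V\<close> 1[symmetric]], assumption)
      (rule has_grad_diff[OF has_grad_add[OF has_grad_cmult[OF gX] has_grad_cmult[OF gZ]] g[OF b(3)]])
  have e2: "pd2 (pd2 \<beta>') p = (a * (Cf \<kappa> (X p) * (1/2 * (pd2 \<beta>' p - pd2 \<beta> p)))
      - b * (Cf \<kappa> (Z p) * (1/2 * (pd2 \<beta>' p + pd2 \<beta> p)))) - pd2 (pd1 \<beta>) p"
    by (rule has_grad_imp_pd(2), rule has_grad_cong[OF \<open>open V\<close> \<open>p \<in> V\<close> 2[symmetric]], assumption)
      (rule has_grad_diff[OF has_grad_diff[OF has_grad_cmult[OF gX] has_grad_cmult[OF gZ]] g[OF b(2)]])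
  have "\<beta>' p = X p + Z p" by (simp add: X_def Z_def field_simps)
  then have S: "Sf \<kappa> (\<beta>' p) = Sf \<kappa> (X p) * Cf \<kappa> (Z p) + Cf \<kappa> (X p) * Sf \<kappa> (Z p)"
    by (simp add: Sf_plus[OF \<kappa>])
  have u: "1/2 * (pd1 \<beta>' p - pd1 \<beta> p) - 1/2 * (pd2 \<beta>' p - pd2 \<beta> p) = b * Sf \<kappa> (Z p)"
    and v: "1/2 * (pd1 \<beta>' p + pd1 \<beta> p) + 1/2 * (pd2 \<beta>' p + pd2 \<beta> p) = a * Sf \<kappa> (X p)"
    using 1[OF \<open>p \<in> V\<close>] 2[OF \<open>p \<in> V\<close>] by (auto simp: field_simps)
  have "pd1 (pd1 \<beta>') p - pd2 (pd2 \<beta>') p =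
     a * Cf \<kappa> (X p) * (1/2 * (pd1 \<beta>' p - pd1 \<beta> p) - 1/2 * (pd2 \<beta>' p - pd2 \<beta> p))
     + b * Cf \<kappa> (Z p) * (1/2 * (pd1 \<beta>' p + pd1 \<beta> p) + 1/2 * (pd2 \<beta>' p + pd2 \<beta> p))
     - (pd1 (pd2 \<beta>) p - pd2 (pd1 \<beta>) p)"
    unfolding e1 e2 by (simp only: algebra_simps)
  then show ?thesis unfolding u v S by (simp add: algebra_simps)
qed

text \<open>Bootstrapping: the equations express the first derivatives of \<open>\<beta>'\<close> by \<open>C\<^sup>1\<close> functions.\<close>

lemma bt_at_C2_on:
  assumes "open V" "C2_on V \<beta>" "C1_on V \<beta>'" and \<kappa>: "\<kappa> = 1 \<or> \<kappa> = -1"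
    and bt: "\<And>q. q \<in> V \<Longrightarrow> bt_at \<kappa> a b \<beta> \<beta>' q"
  shows "C2_on V \<beta>'"
proof -
  note b = C2_on_imp_C1_on[OF assms(2)]
  have S: "C1_on V (\<lambda>q. a * Sf \<kappa> ((1/2) * (\<beta>' q - \<beta> q)))"
     "C1_on V (\<lambda>q. b * Sf \<kappa> ((1/2) * (\<beta>' q + \<beta> q)))"
    using b(1) assms(3) by (intro C1_on_cmult C1_on_Sf[OF \<kappa>] C1_on_add C1_on_diff; simp)+
  have "C1_on V (pd1 \<beta>')"
    by (rule C1_on_cong[OF \<open>open V\<close> _ C1_on_diff[OF C1_on_add[OF S] b(3)]])
      (use bt in \<open>force simp: bt_at_def\<close>)
  moreover have "C1_on V (pd2 \<beta>')"
    by (rule C1_on_cong[OF \<open>open V\<close> _ C1_on_diff[OF C1_on_diff[OF S] b(2)]])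
      (use bt in \<open>force simp: bt_at_def\<close>)
  ultimately show ?thesis using assms(3) by (simp add: C2_on_def)
qed

section \<open>The superposed function satisfies the transformation equations\<close>

text \<open>The equation for \<open>Y\<close> says that the vector \<open>(C Y, S Y)\<close> is proportional to \<open>(C u, c S u)\<close>, and \<open>N\<close> is
  the square of the ratio. With \<open>y = S Y\<close> and \<open>z = C Y\<close>, therefore, \<open>z^2 N\<close>, \<open>y z N\<close> and \<open>\<kappa> y^2 N\<close> are polynomials in \<open>c\<close>, \<open>C u\<close>, \<open>S u\<close>, and after
  multiplication by \<open>N\<close> the claim is a polynomial identity modulo \<open>C^2 + \<kappa> S^2 = 1\<close> and the equation
  for \<open>c\<close>. The number \<open>g\<close> is the derivative of \<open>Y\<close> with respect to \<open>u\<close>.\<close>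

lemma superposition_identity:
  assumes \<kappa>: "\<kappa> = 1 \<or> \<kappa> = -1"
    and c: "c * (a2 - a1) = a1 + a2"
    and Y: "Sf \<kappa> Y * Cf \<kappa> u = c * Cf \<kappa> Y * Sf \<kappa> u"
    and N: "N = (Cf \<kappa> u)\<^sup>2 + of_int \<kappa> * c\<^sup>2 * (Sf \<kappa> u)\<^sup>2" "N \<noteq> 0" and g: "g * N = c"
  shows "a1 * Sf \<kappa> (m + u) + g * (a1 * Sf \<kappa> (m + u) - a2 * Sf \<kappa> (m - u))
    = a2 * Sf \<kappa> (2 * Y - (m + u))"
proof -
  define p q y z P Q k where abbr: "p = Sf \<kappa> u" "q = Cf \<kappa> u" "y = Sf \<kappa> Y" "z = Cf \<kappa> Y"
    "P = Sf \<kappa> m" "Q = Cf \<kappa> m" "k = real_of_int \<kappa>"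
  have q: "q\<^sup>2 = 1 - k * p\<^sup>2" and z: "z\<^sup>2 = 1 - k * y\<^sup>2"
    unfolding abbr by (rule Cf_square[OF \<kappa>])+
  have Y': "y * q = c * z * p" and N': "N = q\<^sup>2 + k * c\<^sup>2 * p\<^sup>2"
    using Y N by (simp_all add: abbr)
  have zN: "z\<^sup>2 * N = q\<^sup>2"
  proof -
    have "z\<^sup>2 * N = z\<^sup>2 * q\<^sup>2 + k * (c * z * p)\<^sup>2" unfolding N' by (simp add: algebra_simps power_mult_distrib)
    also have "\<dots> = (z\<^sup>2 + k * y\<^sup>2) * q\<^sup>2" unfolding Y'[symmetric] by (simp add: algebra_simps power_mult_distrib)
    finally show ?thesis using z by simp
  qed
  have yzN: "y * z * N = c * p * q"
  proof -
    have "y * z * N = (y * q) * z * q + k * c * p * y * (c * z * p)"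
      unfolding N' by (simp add: algebra_simps power2_eq_square)
    also have "\<dots> = c * p * q * (z\<^sup>2 + k * y\<^sup>2)"
      unfolding Y'[symmetric] by (subst Y') (simp add: algebra_simps power2_eq_square Y'[symmetric])
    finally show ?thesis using z by simp
  qed
  have yN: "k * y\<^sup>2 * N = k * c\<^sup>2 * p\<^sup>2"
  proof -
    have "k * y\<^sup>2 = 1 - z\<^sup>2" using z by simp
    then have "k * y\<^sup>2 * N = N - z\<^sup>2 * N" by (simp only: left_diff_distrib mult_1)
    then show ?thesis using zN N' by simp
  qed
  define M where "M = P * q + Q * p"
  define M' where "M' = P * q - Q * p"
  have S: "Sf \<kappa> (2 * Y - (m + u)) = 2 * (y * z) * (Q * q - k * (P * p)) - (z\<^sup>2 - k * y\<^sup>2) * M"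
  proof -
    have "Sf \<kappa> (2 * Y) = 2 * (y * z)" "Cf \<kappa> (2 * Y) = z\<^sup>2 - k * y\<^sup>2"
      using Sf_plus[OF \<kappa>, of Y Y] Cf_plus[OF \<kappa>, of Y Y] by (simp_all add: abbr power2_eq_square)
    then show ?thesis
      by (simp add: Sf_diff[OF \<kappa>] Sf_plus[OF \<kappa>] Cf_plus[OF \<kappa>] M_def abbr)
  qed
  have "N * (a1 * M + g * (a1 * M - a2 * M')) = a1 * M * N + c * (a1 * M - a2 * M')"
    by (simp add: algebra_simps flip: g)
  also have "\<dots> = a2 * (2 * (c * p * q) * (Q * q - k * (P * p)) - (q\<^sup>2 - k * c\<^sup>2 * p\<^sup>2) * M)"
    using q c unfolding N' M_def M'_def by algebra
  also have "\<dots> = a2 * (2 * (y * z * N) * (Q * q - k * (P * p)) - (z\<^sup>2 * N - k * y\<^sup>2 * N) * M)"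
    unfolding zN yzN yN ..
  also have "\<dots> = N * (a2 * Sf \<kappa> (2 * Y - (m + u)))"
    unfolding S by (simp add: algebra_simps)
  finally have "a1 * M + g * (a1 * M - a2 * M') = a2 * Sf \<kappa> (2 * Y - (m + u))"
    using N(2) by simp
  then show ?thesis
    by (simp add: Sf_plus[OF \<kappa>] Sf_diff[OF \<kappa>] M_def M'_def abbr)
qed

text \<open>With \<open>\<alpha>s = \<alpha> + 4 Y\<close> and \<open>dY = g du\<close>, all derivatives on the left can be eliminated by the equations for
  \<open>\<alpha>'\<close> and \<open>\<alpha>''\<close>. The \<open>D+\<close> equation then is the identity above at \<open>m = (\<alpha>' + \<alpha>'') / 4 - \<alpha> / 2\<close>. The \<open>D-\<close>
  equation is the same identity at \<open>n = (\<alpha>' + \<alpha>'') / 4 + \<alpha> / 2\<close> with \<open>b1\<close>, \<open>b2\<close> in place of \<open>a1\<close>, \<open>a2\<close>; as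
  \<open>b\<close> is inversely proportional to \<open>a\<close>, this changes the signs of \<open>c\<close>, \<open>Y\<close> and \<open>g\<close>.\<close>

lemma superposition_bt_at:
  assumes \<kappa>: "\<kappa> = 1 \<or> \<kappa> = -1"
    and ab: "a1 * b1 = \<xi>" "a2 * b2 = \<xi>" "\<xi> \<noteq> 0"
    and c: "c * (a2 - a1) = a1 + a2"
    and bt1: "bt_at \<kappa> a1 b1 \<alpha> \<alpha>' p" and bt2: "bt_at \<kappa> a2 b2 \<alpha> \<alpha>'' p"
    and u: "u = (\<alpha>' p - \<alpha>'' p) / 4" and Y: "\<alpha>s p = \<alpha> p + 4 * Y"
    and SY: "Sf \<kappa> Y * Cf \<kappa> u = c * Cf \<kappa> Y * Sf \<kappa> u"
    and N: "N = (Cf \<kappa> u)\<^sup>2 + of_int \<kappa> * c\<^sup>2 * (Sf \<kappa> u)\<^sup>2" "N \<noteq> 0" and g: "g * N = c"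
    and pd: "pd1 \<alpha>s p = pd1 \<alpha> p + g * (pd1 \<alpha>' p - pd1 \<alpha>'' p)"
      "pd2 \<alpha>s p = pd2 \<alpha> p + g * (pd2 \<alpha>' p - pd2 \<alpha>'' p)"
  shows "bt_at \<kappa> a2 b2 \<alpha>' \<alpha>s p"
proof -
  have 1: "b1 * b2 * a1 = \<xi> * b2"
    unfolding ab(1)[symmetric] by (simp add: ac_simps)
  have 2: "b1 * b2 * a2 = \<xi> * b1"
    unfolding ab(2)[symmetric] by (simp add: ac_simps)
  have "b1 * b2 * (c * (a2 - a1) - (a1 + a2)) =
      c * (b1 * b2 * a2 - b1 * b2 * a1) - (b1 * b2 * a1 + b1 * b2 * a2)"
    by (simp add: algebra_simps)
  also have "\<dots> = \<xi> * (c * (b1 - b2) - (b1 + b2))"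
    unfolding 1 2 by (simp add: algebra_simps)
  finally have "\<xi> * (c * (b1 - b2) - (b1 + b2)) = 0" using c by simp
  then have "c * (b1 - b2) - (b1 + b2) = 0" using ab(3) by simp
  then have cb: "- c * (b2 - b1) = b1 + b2" by (simp add: algebra_simps)
  define m n where "m = (\<alpha>' p + \<alpha>'' p) / 4 - \<alpha> p / 2" and "n = (\<alpha>' p + \<alpha>'' p) / 4 + \<alpha> p / 2"
  have m: "(\<alpha>' p - \<alpha> p) / 2 = m + u" "(\<alpha>'' p - \<alpha> p) / 2 = m - u"
      "(\<alpha>s p - \<alpha>' p) / 2 = 2 * Y - (m + u)"
    and n: "(\<alpha>' p + \<alpha> p) / 2 = n + u" "(\<alpha>'' p + \<alpha> p) / 2 = n - u"
      "(\<alpha>s p + \<alpha>' p) / 2 = - (2 * (- Y) - (n + u))"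
    by (simp_all add: m_def n_def u Y field_simps)
  note e1 = bt1[unfolded bt_at_iff_characteristic m n] and e2 = bt2[unfolded bt_at_iff_characteristic m n]
  have 1: "a1 * Sf \<kappa> (m + u) + g * (a1 * Sf \<kappa> (m + u) - a2 * Sf \<kappa> (m - u))
    = a2 * Sf \<kappa> (2 * Y - (m + u))"
    by (rule superposition_identity[OF \<kappa> c SY N g])
  have 2: "b1 * Sf \<kappa> (n + u) + (- g) * (b1 * Sf \<kappa> (n + u) - b2 * Sf \<kappa> (n - u))
    = b2 * Sf \<kappa> (2 * (- Y) - (n + u))"
    by (rule superposition_identity[OF \<kappa> cb, where N = N]) (use SY N g in simp_all)
  have "(pd1 \<alpha>s p + pd2 \<alpha>s p) + (pd1 \<alpha>' p + pd2 \<alpha>' p)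
     = (pd1 \<alpha>' p + pd2 \<alpha>' p + (pd1 \<alpha> p + pd2 \<alpha> p))
       + g * ((pd1 \<alpha>' p + pd2 \<alpha>' p + (pd1 \<alpha> p + pd2 \<alpha> p)) - (pd1 \<alpha>'' p + pd2 \<alpha>'' p + (pd1 \<alpha> p + pd2 \<alpha> p)))"
    unfolding pd by (simp add: algebra_simps)
  also have "\<dots> = 2 * (a1 * Sf \<kappa> (m + u) + g * (a1 * Sf \<kappa> (m + u) - a2 * Sf \<kappa> (m - u)))"
    unfolding e1[THEN conjunct1] e2[THEN conjunct1] by (simp add: algebra_simps)
  finally have 3: "(pd1 \<alpha>s p + pd2 \<alpha>s p) + (pd1 \<alpha>' p + pd2 \<alpha>' p) = 2 * a2 * Sf \<kappa> (2 * Y - (m + u))"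
    unfolding 1 by simp
  have "(pd1 \<alpha>s p - pd2 \<alpha>s p) - (pd1 \<alpha>' p - pd2 \<alpha>' p)
     = - (pd1 \<alpha>' p - pd2 \<alpha>' p - (pd1 \<alpha> p - pd2 \<alpha> p))
       + g * ((pd1 \<alpha>' p - pd2 \<alpha>' p - (pd1 \<alpha> p - pd2 \<alpha> p)) - (pd1 \<alpha>'' p - pd2 \<alpha>'' p - (pd1 \<alpha> p - pd2 \<alpha> p)))"
    unfolding pd by (simp add: algebra_simps)
  also have "\<dots> = - 2 * (b1 * Sf \<kappa> (n + u) + (- g) * (b1 * Sf \<kappa> (n + u) - b2 * Sf \<kappa> (n - u)))"
    unfolding e1[THEN conjunct2] e2[THEN conjunct2] by (simp add: algebra_simps)
  finally have 4: "(pd1 \<alpha>s p - pd2 \<alpha>s p) - (pd1 \<alpha>' p - pd2 \<alpha>' p)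
      = 2 * b2 * Sf \<kappa> (- (2 * (- Y) - (n + u)))"
    unfolding 2 Sf_minus by simp
  show ?thesis unfolding bt_at_iff_characteristic m(3) n(3) using 3 4 by simp
qed

section \<open>A smooth solution of the superposition formula\<close>

lemma range_tanh: "range (tanh :: real \<Rightarrow> real) = {-1<..<1}"
proof (intro equalityI subsetI)
  fix x :: real assume x: "x \<in> {-1<..<1}"
  have e: "exp (- 2 * artanh x) = (1 - x) / (1 + x)"
    using x by (simp add: artanh_def exp_minus)
  have "tanh (artanh x) = x"
    unfolding tanh_real_altdef e using x by (simp add: field_simps)
  then show "x \<in> range tanh" by (metis rangeI)
qed (use tanh_real_bounds in auto)

lemma tanh_artanh: "x \<in> {-1<..<1} \<Longrightarrow> tanh (artanh x) = (x::real)"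
  using range_tanh artanh_tanh_real by (metis imageE)

text \<open>The equation says that the direction with angle \<open>G x\<close> is parallel to \<open>(cos x, k sin x)\<close>. For \<open>k > 0\<close> the
  angle from \<open>(cos x, sin x)\<close> to that vector stays strictly between \<open>- pi / 2\<close> and \<open>pi / 2\<close>, so it is an
  arctangent with a denominator that never vanishes, and adding it to \<open>x\<close> gives one smooth function on
  the line, where \<open>arctan (k * tan x)\<close> would jump at each pole.\<close>

lemma tan_lift_pos:
  fixes k :: real
  assumes k: "k > 0"
  shows "\<exists>G. \<forall>x. (G has_real_derivative k / ((cos x)\<^sup>2 + k\<^sup>2 * (sin x)\<^sup>2)) (at x) \<and>
    sin (G x) * cos x = k * cos (G x) * sin x"
proof (rule exI[where x = "\<lambda>x. x + arctan ((k - 1) * sin x * cos x / ((cos x)\<^sup>2 + k * (sin x)\<^sup>2))"],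
    intro allI conjI)
  fix x :: real
  define D where "D = (\<lambda>x. (cos x)\<^sup>2 + k * (sin x)\<^sup>2)"
  define M where "M = (\<lambda>x. (k - 1) * sin x * cos x)"
  have pos: "(cos x)\<^sup>2 + l * (sin x)\<^sup>2 > 0" if "l > 0" for l :: real
    using that sin_cos_squared_add[of x]
    by (cases "sin x = 0") (auto intro!: add_nonneg_pos)
  have D: "D x > 0" using pos[OF k] by (simp add: D_def)
  \<comment> \<open>The pair \<open>(D, M)\<close> is the vector \<open>(cos x, k * sin x)\<close> rotated by the angle \<open>- x\<close>.\<close>
  have E: "(D x)\<^sup>2 + (M x)\<^sup>2 = (cos x)\<^sup>2 + k\<^sup>2 * (sin x)\<^sup>2"
    using sin_cos_squared_add[of x] unfolding D_def M_def by algebra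
  have E0: "(cos x)\<^sup>2 + k\<^sup>2 * (sin x)\<^sup>2 > 0" using pos[of "k\<^sup>2"] k by simp
  have dD: "(D has_real_derivative 2 * (k - 1) * sin x * cos x) (at x)"
    unfolding D_def by (auto intro!: derivative_eq_intros simp: algebra_simps)
  have dM: "(M has_real_derivative (k - 1) * ((cos x)\<^sup>2 - (sin x)\<^sup>2)) (at x)"
    unfolding M_def by (auto intro!: derivative_eq_intros simp: algebra_simps power2_eq_square)
  define M1 D1 where "M1 = (k - 1) * ((cos x)\<^sup>2 - (sin x)\<^sup>2)" and "D1 = 2 * (k - 1) * sin x * cos x"
  have "((\<lambda>x. x + arctan (M x / D x)) has_real_derivative
      1 + inverse (1 + (M x / D x)\<^sup>2) * ((M1 * D x - M x * D1) / (D x * D x))) (at x)"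
    using D unfolding M1_def D1_def
    by (intro DERIV_add DERIV_ident DERIV_chain2[OF DERIV_arctan] DERIV_divide[OF dM dD]) simp
  also have "1 + inverse (1 + (M x / D x)\<^sup>2) * ((M1 * D x - M x * D1) / (D x * D x))
      = 1 + (M1 * D x - M x * D1) / ((D x)\<^sup>2 + (M x)\<^sup>2)"
  proof -
    have "1 + (M x / D x)\<^sup>2 = ((D x)\<^sup>2 + (M x)\<^sup>2) / (D x * D x)"
      using D by (simp add: field_simps power2_eq_square)
    then show ?thesis using D by simp
  qed
  also have "\<dots> = k / ((cos x)\<^sup>2 + k\<^sup>2 * (sin x)\<^sup>2)"
  proof -
    have "(D x)\<^sup>2 + (M x)\<^sup>2 + (M1 * D x - M x * D1) = k"
      using sin_cos_squared_add[of x] unfolding D_def M_def M1_def D1_def by algebra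
    then have "M1 * D x - M x * D1 = k - ((cos x)\<^sup>2 + k\<^sup>2 * (sin x)\<^sup>2)" using E by simp
    then show ?thesis unfolding E using E0 by (simp add: diff_divide_distrib)
  qed
  finally show "((\<lambda>x. x + arctan ((k - 1) * sin x * cos x / ((cos x)\<^sup>2 + k * (sin x)\<^sup>2)))
      has_real_derivative k / ((cos x)\<^sup>2 + k\<^sup>2 * (sin x)\<^sup>2)) (at x)"
    by (simp add: D_def M_def)
  define v where "v = arctan (M x / D x)"
  have "sin v = M x / D x * cos v"
    using tan_arctan[of "M x / D x"] cos_arctan_not_zero[of "M x / D x"]
    by (simp add: v_def tan_def field_simps)
  then have v: "D x * sin v = M x * cos v" using D by (simp add: field_simps)
  have "sin (x + v) * cos x - k * cos (x + v) * sin x = D x * sin v - M x * cos v"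
    unfolding sin_add cos_add D_def M_def by (simp add: algebra_simps power2_eq_square)
  with v show "sin (x + arctan ((k - 1) * sin x * cos x / ((cos x)\<^sup>2 + k * (sin x)\<^sup>2))) * cos x
     = k * cos (x + arctan ((k - 1) * sin x * cos x / ((cos x)\<^sup>2 + k * (sin x)\<^sup>2))) * sin x"
    by (simp add: D_def M_def v_def)
qed

text \<open>For \<open>\<kappa> = 1\<close> a negative \<open>c\<close> is handled by \<open>- G\<close>, with \<open>G\<close> belonging to \<open>- c\<close>. For \<open>\<kappa> = -1\<close> the function is
  \<open>artanh (c * tanh x)\<close>, and \<open>C^2 - c^2 S^2 = C^2 (1 - (c T)^2)\<close> is positive exactly where the argument
  lies in \<open>(-1, 1)\<close>.\<close>

lemma superposition_lift:
  assumes \<kappa>: "\<kappa> = 1 \<or> \<kappa> = -1" and c: "c \<noteq> 0"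
  shows "\<exists>G. \<forall>x. c * Tf \<kappa> x \<in> range (Tf \<kappa>) \<longrightarrow>
     (G has_real_derivative c / ((Cf \<kappa> x)\<^sup>2 + of_int \<kappa> * c\<^sup>2 * (Sf \<kappa> x)\<^sup>2)) (at x) \<and>
     Sf \<kappa> (G x) * Cf \<kappa> x = c * Cf \<kappa> (G x) * Sf \<kappa> x \<and>
     (Cf \<kappa> x)\<^sup>2 + of_int \<kappa> * c\<^sup>2 * (Sf \<kappa> x)\<^sup>2 > 0"
  using \<kappa>
proof
  assume k: "\<kappa> = 1"
  have pos: "(cos x)\<^sup>2 + c\<^sup>2 * (sin x)\<^sup>2 > 0" for x :: real
    using c sin_cos_squared_add[of x]
    by (cases "sin x = 0") (auto intro!: add_nonneg_pos)
  obtain G where G: "\<And>x. (G has_real_derivative \<bar>c\<bar> / ((cos x)\<^sup>2 + c\<^sup>2 * (sin x)\<^sup>2)) (at x)"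
    "\<And>x. sin (G x) * cos x = \<bar>c\<bar> * cos (G x) * sin x"
    using tan_lift_pos[of "\<bar>c\<bar>"] c by auto
  show ?thesis
  proof (cases "c > 0")
    case True
    then show ?thesis using G pos by (intro exI[of _ G]) (simp add: k Sf_def Cf_def)
  next
    case False
    have "((\<lambda>x. - G x) has_real_derivative c / ((cos x)\<^sup>2 + c\<^sup>2 * (sin x)\<^sup>2)) (at x)" for x
      using DERIV_minus[OF G(1)[of x]] False by simp
    then show ?thesis using G(2) False pos
      by (intro exI[of _ "\<lambda>x. - G x"]) (simp add: k Sf_def Cf_def)
  qed
next
  assume k: "\<kappa> = -1"
  have "((\<lambda>x. artanh (c * tanh x)) has_real_derivative c / ((cosh x)\<^sup>2 - c\<^sup>2 * (sinh x)\<^sup>2)) (at x) \<and>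
     sinh (artanh (c * tanh x)) * cosh x = c * cosh (artanh (c * tanh x)) * sinh x \<and>
     (cosh x)\<^sup>2 - c\<^sup>2 * (sinh x)\<^sup>2 > 0"
    if x: "c * tanh x \<in> {-1<..<1}" for x :: real
  proof (intro conjI)
    have t: "tanh x * cosh x = sinh x" by (simp add: tanh_def)
    have "(c * tanh x)\<^sup>2 < 1" using x by (simp add: abs_square_less_1 abs_if)
    then have "(cosh x)\<^sup>2 * (1 - (c * tanh x)\<^sup>2) > 0" by simp
    also have eq: "(cosh x)\<^sup>2 * (1 - (c * tanh x)\<^sup>2) = (cosh x)\<^sup>2 - c\<^sup>2 * (sinh x)\<^sup>2"
      by (simp add: t[symmetric] algebra_simps power_mult_distrib)
    finally show pos: "(cosh x)\<^sup>2 - c\<^sup>2 * (sinh x)\<^sup>2 > 0" .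
    have "(cosh x)\<^sup>2 * (1 - (tanh x)\<^sup>2) = (cosh x)\<^sup>2 - (tanh x * cosh x)\<^sup>2"
      by (simp add: algebra_simps power_mult_distrib)
    also have "\<dots> = 1" unfolding t by (simp add: cosh_square_eq)
    finally have d: "1 - (tanh x)\<^sup>2 = 1 / (cosh x)\<^sup>2" by (simp add: field_simps)
    have "((\<lambda>x. artanh (c * tanh x)) has_real_derivative
        1 / (1 - (c * tanh x)\<^sup>2) * (c * (1 - (tanh x)\<^sup>2))) (at x)"
      using x by (intro DERIV_chain2[of artanh] artanh_real_has_field_derivative DERIV_cmult)
        (auto intro!: derivative_eq_intros)
    also have "1 / (1 - (c * tanh x)\<^sup>2) * (c * (1 - (tanh x)\<^sup>2)) = c / ((cosh x)\<^sup>2 - c\<^sup>2 * (sinh x)\<^sup>2)"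
      unfolding d eq[symmetric] by simp
    finally show "((\<lambda>x. artanh (c * tanh x)) has_real_derivative
        c / ((cosh x)\<^sup>2 - c\<^sup>2 * (sinh x)\<^sup>2)) (at x)" .
    have "sinh (artanh (c * tanh x)) = c * tanh x * cosh (artanh (c * tanh x))"
      using tanh_artanh[OF x] by (simp add: tanh_def field_simps)
    then show "sinh (artanh (c * tanh x)) * cosh x = c * cosh (artanh (c * tanh x)) * sinh x"
      by (simp add: t[symmetric])
  qed
  then show ?thesis
    using range_tanh by (intro exI[of _ "\<lambda>x. artanh (c * tanh x)"]) (simp add: k Sf_def Cf_def Tf_def)
qed

section \<open>Closed quadrilaterals of transformations\<close>

text \<open>Going around the quadrilateral, the derivatives cancel. In terms of \<open>P\<close>, \<open>R\<close>, \<open>A\<close>, \<open>B\<close> the eight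
  arguments are \<open>P + A\<close>, \<open>P - A\<close>, \<open>R + A\<close>, \<open>R - A\<close>, \<open>B + P\<close>, \<open>B - P\<close>, \<open>B + R\<close>, \<open>B - R\<close>, so that \<open>C(A)\<close>
  factors out of one relation and \<open>C(B)\<close> out of the other. The second relation comes with the
  coefficients \<open>b2\<close>, \<open>b1\<close>, which are proportional to \<open>a1\<close>, \<open>a2\<close>.\<close>

lemma quadrilateral_factorization:
  assumes \<kappa>: "\<kappa> = 1 \<or> \<kappa> = -1"
    and ab: "a1 * b1 = \<xi>" "a2 * b2 = \<xi>" "\<xi> \<noteq> 0"
    and bt: "bt_at \<kappa> a1 b1 \<alpha> \<alpha>' p" "bt_at \<kappa> a2 b2 \<alpha> \<alpha>'' p"
      "bt_at \<kappa> a2 b2 \<alpha>' \<beta> p" "bt_at \<kappa> a1 b1 \<alpha>'' \<beta> p"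
    and P: "P = (\<beta> p - \<alpha> p + \<alpha>' p - \<alpha>'' p) / 4" and R: "R = (\<beta> p - \<alpha> p - \<alpha>' p + \<alpha>'' p) / 4"
    and A: "A = (\<alpha>' p + \<alpha>'' p - \<alpha> p - \<beta> p) / 4" and B: "B = (\<alpha>' p + \<alpha>'' p + \<alpha> p + \<beta> p) / 4"
  shows "(a1 * Sf \<kappa> P - a2 * Sf \<kappa> R) * Cf \<kappa> A = 0"
    and "(a1 * Sf \<kappa> P - a2 * Sf \<kappa> R) * Cf \<kappa> B = 0"
proof -
  have ang: "(\<alpha>' p - \<alpha> p) / 2 = P + A" "(\<alpha>'' p - \<alpha> p) / 2 = R + A"
    "(\<beta> p - \<alpha>' p) / 2 = R - A" "(\<beta> p - \<alpha>'' p) / 2 = P - A"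
    "(\<alpha>' p + \<alpha> p) / 2 = B - R" "(\<alpha>'' p + \<alpha> p) / 2 = B - P"
    "(\<beta> p + \<alpha>' p) / 2 = B + P" "(\<beta> p + \<alpha>'' p) / 2 = B + R"
    by (simp_all add: P R A B field_simps)
  note e = bt[unfolded bt_at_iff_characteristic ang]
  have "a1 * Sf \<kappa> (P + A) + a1 * Sf \<kappa> (P - A) = a2 * Sf \<kappa> (R + A) + a2 * Sf \<kappa> (R - A)"
    using e(1)[THEN conjunct1] e(2)[THEN conjunct1] e(3)[THEN conjunct1] e(4)[THEN conjunct1]
    by linarith
  then show "(a1 * Sf \<kappa> P - a2 * Sf \<kappa> R) * Cf \<kappa> A = 0"
    unfolding Sf_plus[OF \<kappa>] Sf_diff[OF \<kappa>] by (simp add: algebra_simps)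
  have "b1 * Sf \<kappa> (B - R) + b2 * Sf \<kappa> (B + P) = b2 * Sf \<kappa> (B - P) + b1 * Sf \<kappa> (B + R)"
    using e(1)[THEN conjunct2] e(2)[THEN conjunct2] e(3)[THEN conjunct2] e(4)[THEN conjunct2]
    by linarith
  then have b: "(b2 * Sf \<kappa> P - b1 * Sf \<kappa> R) * Cf \<kappa> B = 0"
    unfolding Sf_plus[OF \<kappa>] Sf_diff[OF \<kappa>] by (simp add: algebra_simps)
  have "\<xi> * ((a1 * Sf \<kappa> P - a2 * Sf \<kappa> R) * Cf \<kappa> B)
      = a1 * \<xi> * Sf \<kappa> P * Cf \<kappa> B - a2 * \<xi> * Sf \<kappa> R * Cf \<kappa> B"
    by (simp add: algebra_simps)
  also have "\<dots> = a1 * (a2 * b2) * Sf \<kappa> P * Cf \<kappa> B - a2 * (a1 * b1) * Sf \<kappa> R * Cf \<kappa> B"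
    unfolding ab ..
  also have "\<dots> = a1 * a2 * ((b2 * Sf \<kappa> P - b1 * Sf \<kappa> R) * Cf \<kappa> B)"
    by (simp add: algebra_simps)
  finally show "(a1 * Sf \<kappa> P - a2 * Sf \<kappa> R) * Cf \<kappa> B = 0"
    using b ab(3) by simp
qed

text \<open>Differentiate \<open>C(f) = 0\<close>: where \<open>C\<close> vanishes, its derivative \<open>- \<kappa> S\<close> does not.\<close>

lemma grad_zero_where_Cf_vanishes:
  assumes \<kappa>: "\<kappa> = 1 \<or> \<kappa> = -1" and "open N" "p \<in> N"
    and "has_grad f a b p" "\<And>q. q \<in> N \<Longrightarrow> Cf \<kappa> (f q) = 0"
  shows "a = 0" "b = 0"
proof -
  have S: "Sf \<kappa> (f p) \<noteq> 0"
    using Cf_square[OF \<kappa>, of "f p"] assms(3,5) by auto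
  have "has_grad (\<lambda>q. Cf \<kappa> (f q)) (- of_int \<kappa> * Sf \<kappa> (f p) * a) (- of_int \<kappa> * Sf \<kappa> (f p) * b) p"
    using assms(4) Cf_has_derivative[OF \<kappa>] by (rule has_grad_chain)
  moreover have "has_grad (\<lambda>q. Cf \<kappa> (f q)) 0 0 p"
    by (rule has_grad_cong[OF assms(2,3) _ has_grad_const[of 0]]) (simp add: assms(5))
  ultimately have "- of_int \<kappa> * Sf \<kappa> (f p) * a = 0" "- of_int \<kappa> * Sf \<kappa> (f p) * b = 0"
    using has_grad_imp_pd by metis+
  then show "a = 0" "b = 0" using S \<kappa> by auto
qed

text \<open>The common factor \<open>F\<close> of the two relations cannot vanish at one point and be nonzero at another one.
  Where it is nonzero, \<open>A\<close> and \<open>B\<close> have zero gradient, hence the derivatives of \<open>\<alpha>''\<close> and \<open>\<beta>\<close> are the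
  negatives of those of \<open>\<alpha>'\<close> and \<open>\<alpha>\<close>; inserting the equations for \<open>(\<alpha>, \<alpha>')\<close> and \<open>(\<alpha>', \<beta>)\<close> gives
  \<open>dF = 0\<close>. The square \<open>F^2\<close> also has zero derivative where \<open>F\<close> vanishes, so it is constant.\<close>

lemma quadrilateral_dichotomy:
  fixes \<alpha> \<alpha>' \<alpha>'' \<beta> :: "real \<times> real \<Rightarrow> real"
  assumes \<kappa>: "\<kappa> = 1 \<or> \<kappa> = -1"
    and ab: "a1 * b1 = \<xi>" "a2 * b2 = \<xi>" "\<xi> \<noteq> 0"
    and V: "open V" "connected V"
    and C1: "C1_on V \<alpha>" "C1_on V \<alpha>'" "C1_on V \<alpha>''" "C1_on V \<beta>"
    and bt: "\<And>q. q \<in> V \<Longrightarrow> bt_at \<kappa> a1 b1 \<alpha> \<alpha>' q" "\<And>q. q \<in> V \<Longrightarrow> bt_at \<kappa> a2 b2 \<alpha> \<alpha>'' q"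
      "\<And>q. q \<in> V \<Longrightarrow> bt_at \<kappa> a2 b2 \<alpha>' \<beta> q" "\<And>q. q \<in> V \<Longrightarrow> bt_at \<kappa> a1 b1 \<alpha>'' \<beta> q"
  shows "(\<forall>p\<in>V. a1 * Sf \<kappa> ((\<beta> p - \<alpha> p + \<alpha>' p - \<alpha>'' p) / 4)
                = a2 * Sf \<kappa> ((\<beta> p - \<alpha> p - \<alpha>' p + \<alpha>'' p) / 4)) \<or>
    (\<forall>p\<in>V. Cf \<kappa> ((\<alpha>' p + \<alpha>'' p - \<alpha> p - \<beta> p) / 4) = 0 \<and>
           Cf \<kappa> ((\<alpha>' p + \<alpha>'' p + \<alpha> p + \<beta> p) / 4) = 0)"
proof -
  define P where "P = (\<lambda>p. (1/4) * (\<beta> p - \<alpha> p + \<alpha>' p - \<alpha>'' p))"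
  define R where "R = (\<lambda>p. (1/4) * (\<beta> p - \<alpha> p - \<alpha>' p + \<alpha>'' p))"
  define A where "A = (\<lambda>p. (1/4) * (\<alpha>' p + \<alpha>'' p - \<alpha> p - \<beta> p))"
  define B where "B = (\<lambda>p. (1/4) * (\<alpha>' p + \<alpha>'' p + \<alpha> p + \<beta> p))"
  define F where "F = (\<lambda>p. a1 * Sf \<kappa> (P p) - a2 * Sf \<kappa> (R p))"
  have fac: "F p * Cf \<kappa> (A p) = 0" "F p * Cf \<kappa> (B p) = 0" if "p \<in> V" for p
    using quadrilateral_factorization[OF \<kappa> ab bt[OF that], of "P p" "R p" "A p" "B p"]
    by (simp_all add: F_def P_def R_def A_def B_def)
  have C1F: "C1_on V F"
    unfolding F_def P_def R_def
    by (intro C1_on_diff C1_on_add C1_on_cmult C1_on_Sf[OF \<kappa>] C1)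
  have contF: "continuous_on V F" using C1F by (rule C1_on_imp_continuous_on)
  have zero: "has_grad F 0 0 p" if p: "p \<in> V" and Fp: "F p \<noteq> 0" for p
  proof -
    \<comment> \<open>A neighbourhood, because \<open>C(A)\<close> and \<open>C(B)\<close> are to be differentiated at \<open>p\<close>.\<close>
    define N where "N = V \<inter> F -` (- {0})"
    have N: "open N" "p \<in> N"
      using continuous_open_preimage[OF contF V(1), of "- {0}"] p Fp by (auto simp: N_def)
    have CA: "Cf \<kappa> (A q) = 0" and CB: "Cf \<kappa> (B q) = 0" if "q \<in> N" for q
      using fac[of q] that by (auto simp: N_def)
    note g = C1_on_imp_has_grad[OF C1(1) p] C1_on_imp_has_grad[OF C1(2) p]
      C1_on_imp_has_grad[OF C1(3) p] C1_on_imp_has_grad[OF C1(4) p]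
    have gA: "has_grad A ((1/4) * (pd1 \<alpha>' p + pd1 \<alpha>'' p - pd1 \<alpha> p - pd1 \<beta> p))
        ((1/4) * (pd2 \<alpha>' p + pd2 \<alpha>'' p - pd2 \<alpha> p - pd2 \<beta> p)) p"
      unfolding A_def by (intro has_grad_cmult has_grad_add has_grad_diff g)
    have gB: "has_grad B ((1/4) * (pd1 \<alpha>' p + pd1 \<alpha>'' p + pd1 \<alpha> p + pd1 \<beta> p))
        ((1/4) * (pd2 \<alpha>' p + pd2 \<alpha>'' p + pd2 \<alpha> p + pd2 \<beta> p)) p"
      unfolding B_def by (intro has_grad_cmult has_grad_add has_grad_diff g)
    have op: "pd1 \<alpha>'' p = - pd1 \<alpha>' p" "pd1 \<beta> p = - pd1 \<alpha> p"
        "pd2 \<alpha>'' p = - pd2 \<alpha>' p" "pd2 \<beta> p = - pd2 \<alpha> p"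
      using grad_zero_where_Cf_vanishes[OF \<kappa> N gA CA] grad_zero_where_Cf_vanishes[OF \<kappa> N gB CB]
      by auto
    have gP: "has_grad P ((1/4) * (pd1 \<beta> p - pd1 \<alpha> p + pd1 \<alpha>' p - pd1 \<alpha>'' p))
        ((1/4) * (pd2 \<beta> p - pd2 \<alpha> p + pd2 \<alpha>' p - pd2 \<alpha>'' p)) p"
      unfolding P_def by (intro has_grad_cmult has_grad_add has_grad_diff g)
    have gR: "has_grad R ((1/4) * (pd1 \<beta> p - pd1 \<alpha> p - pd1 \<alpha>' p + pd1 \<alpha>'' p))
        ((1/4) * (pd2 \<beta> p - pd2 \<alpha> p - pd2 \<alpha>' p + pd2 \<alpha>'' p)) p"
      unfolding R_def by (intro has_grad_cmult has_grad_add has_grad_diff g)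
    define F1 where "F1 = a1 * (Cf \<kappa> (P p) * ((1/4) * (pd1 \<beta> p - pd1 \<alpha> p + pd1 \<alpha>' p - pd1 \<alpha>'' p)))
       - a2 * (Cf \<kappa> (R p) * ((1/4) * (pd1 \<beta> p - pd1 \<alpha> p - pd1 \<alpha>' p + pd1 \<alpha>'' p)))"
    define F2 where "F2 = a1 * (Cf \<kappa> (P p) * ((1/4) * (pd2 \<beta> p - pd2 \<alpha> p + pd2 \<alpha>' p - pd2 \<alpha>'' p)))
       - a2 * (Cf \<kappa> (R p) * ((1/4) * (pd2 \<beta> p - pd2 \<alpha> p - pd2 \<alpha>' p + pd2 \<alpha>'' p)))"
    have gF: "has_grad F F1 F2 p"
      unfolding F_def F1_def F2_def
      by (intro has_grad_diff has_grad_cmult has_grad_chain[OF gP Sf_has_derivative]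
          has_grad_chain[OF gR Sf_has_derivative])
    have ang: "(\<alpha>' p - \<alpha> p) / 2 = P p + A p" "(\<beta> p - \<alpha>' p) / 2 = R p - A p"
      "(\<alpha>' p + \<alpha> p) / 2 = B p - R p" "(\<beta> p + \<alpha>' p) / 2 = B p + P p"
      by (simp_all add: P_def R_def A_def B_def field_simps)
    note e1 = bt(1)[OF p, unfolded bt_at_iff_characteristic ang Sf_plus[OF \<kappa>] Sf_diff[OF \<kappa>]
        CA[OF N(2)] CB[OF N(2)] op]
    note e3 = bt(3)[OF p, unfolded bt_at_iff_characteristic ang Sf_plus[OF \<kappa>] Sf_diff[OF \<kappa>]
        CA[OF N(2)] CB[OF N(2)] op]
    have h: "F1 = a1 * Cf \<kappa> (P p) * ((pd1 \<alpha>' p - pd1 \<alpha> p) / 2) + a2 * Cf \<kappa> (R p) * ((pd1 \<alpha>' p + pd1 \<alpha> p) / 2)"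
      "F2 = a1 * Cf \<kappa> (P p) * ((pd2 \<alpha>' p - pd2 \<alpha> p) / 2) + a2 * Cf \<kappa> (R p) * ((pd2 \<alpha>' p + pd2 \<alpha> p) / 2)"
      unfolding F1_def F2_def op by (simp_all add: field_simps)
    have d: "((pd1 \<alpha>' p - pd1 \<alpha> p) / 2) + ((pd2 \<alpha>' p - pd2 \<alpha> p) / 2) = - a2 * Cf \<kappa> (R p) * Sf \<kappa> (A p)"
      "((pd1 \<alpha>' p + pd1 \<alpha> p) / 2) + ((pd2 \<alpha>' p + pd2 \<alpha> p) / 2) = a1 * Cf \<kappa> (P p) * Sf \<kappa> (A p)"
      "((pd1 \<alpha>' p - pd1 \<alpha> p) / 2) - ((pd2 \<alpha>' p - pd2 \<alpha> p) / 2) = b1 * Sf \<kappa> (B p) * Cf \<kappa> (R p)"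
      "((pd1 \<alpha>' p + pd1 \<alpha> p) / 2) - ((pd2 \<alpha>' p + pd2 \<alpha> p) / 2) = - b2 * Sf \<kappa> (B p) * Cf \<kappa> (P p)"
      using e1 e3 by (simp_all add: field_simps)
    have "F1 + F2 = a1 * Cf \<kappa> (P p) * (((pd1 \<alpha>' p - pd1 \<alpha> p) / 2) + ((pd2 \<alpha>' p - pd2 \<alpha> p) / 2))
        + a2 * Cf \<kappa> (R p) * (((pd1 \<alpha>' p + pd1 \<alpha> p) / 2) + ((pd2 \<alpha>' p + pd2 \<alpha> p) / 2))"
      unfolding h by (simp only: algebra_simps)
    also have "\<dots> = 0" unfolding d by simp
    finally have s: "F1 + F2 = 0" .
    have "F1 - F2 = a1 * Cf \<kappa> (P p) * (((pd1 \<alpha>' p - pd1 \<alpha> p) / 2) - ((pd2 \<alpha>' p - pd2 \<alpha> p) / 2))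
        + a2 * Cf \<kappa> (R p) * (((pd1 \<alpha>' p + pd1 \<alpha> p) / 2) - ((pd2 \<alpha>' p + pd2 \<alpha> p) / 2))"
      unfolding h by (simp only: algebra_simps)
    also have "\<dots> = (a1 * b1 - a2 * b2) * (Sf \<kappa> (B p) * Cf \<kappa> (P p) * Cf \<kappa> (R p))"
      unfolding d by (simp add: algebra_simps)
    also have "\<dots> = 0" using ab by simp
    finally have "F1 - F2 = 0" .
    with s have "F1 = 0" "F2 = 0" by simp_all
    with gF show ?thesis by simp
  qed
  have "((\<lambda>q. (F q)\<^sup>2) has_derivative (\<lambda>h. 0)) (at p within V)" if p: "p \<in> V" for p
  proof -
    have "has_grad (\<lambda>q. (F q)\<^sup>2) (2 * F p * pd1 F p) (2 * F p * pd2 F p) p"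
      by (rule has_grad_chain[OF C1_on_imp_has_grad[OF C1F p]]) (auto intro!: derivative_eq_intros)
    moreover have "2 * F p * pd1 F p = 0" "2 * F p * pd2 F p = 0"
      using zero[OF p] has_grad_imp_pd[of F 0 0 p] by auto
    ultimately have "has_grad (\<lambda>q. (F q)\<^sup>2) 0 0 p" by (simp only:)
    then show ?thesis by (simp add: has_grad_def has_derivative_at_withinI)
  qed
  then have "(\<lambda>q. (F q)\<^sup>2) constant_on V"
    using V contF
    by (intro has_derivative_zero_connected_constant_on[of V "{}"]) (auto intro: continuous_on_power)
  then obtain k where k: "\<And>q. q \<in> V \<Longrightarrow> (F q)\<^sup>2 = k" by (auto simp: constant_on_def)
  show ?thesis
  proof (cases "k = 0")
    case True
    then have "F p = 0" if "p \<in> V" for p using k[OF that] by simp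
    then show ?thesis by (simp add: F_def P_def R_def)
  next
    case False
    then have "F p \<noteq> 0" if "p \<in> V" for p using k[OF that] by auto
    then have "Cf \<kappa> (A p) = 0 \<and> Cf \<kappa> (B p) = 0" if "p \<in> V" for p using fac[OF that] that by auto
    then show ?thesis by (simp add: A_def B_def)
  qed
qed

text \<open>The multiples of \<open>pi\<close> form a discrete set.\<close>

lemma sin_zero_on_connected:
  fixes f :: "'a::topological_space \<Rightarrow> real"
  assumes "connected V" "continuous_on V f" "\<And>p. p \<in> V \<Longrightarrow> sin (f p) = 0"
  shows "\<exists>n::int. \<forall>p\<in>V. f p = of_int n * pi"
proof (cases "V = {}")
  case False
  then obtain p0 where p0: "p0 \<in> V" by auto
  have "f constant_on V"
  proof (rule continuous_discrete_range_constant[OF assms(1,2)])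
    fix p assume p: "p \<in> V"
    have "pi \<le> norm (f q - f p)" if q: "q \<in> V" "f q \<noteq> f p" for q
    proof -
      obtain m n :: int where mn: "f q = of_int m * pi" "f p = of_int n * pi"
        using assms(3)[OF p] assms(3)[OF q(1)] by (auto simp: sin_zero_iff_int2)
      have "m \<noteq> n" using q(2) mn by auto
      then have "1 \<le> \<bar>real_of_int (m - n)\<bar>" by linarith
      then have "1 * pi \<le> \<bar>real_of_int (m - n)\<bar> * pi" by (intro mult_right_mono) auto
      also have "\<dots> = norm (f q - f p)"
        unfolding mn by (simp add: left_diff_distrib[symmetric] abs_mult)
      finally show ?thesis by simp
    qed
    then show "\<exists>e>0. \<forall>q. q \<in> V \<and> f q \<noteq> f p \<longrightarrow> e \<le> norm (f q - f p)"
      using pi_gt_zero by blast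
  qed
  then have "\<forall>p\<in>V. f p = f p0" using p0 by (auto simp: constant_on_def)
  then show ?thesis using assms(3)[OF p0] by (auto simp: sin_zero_iff_int2)
qed auto

lemma reflected_on_of_cos_zero:
  assumes V: "connected V"
    and cont: "continuous_on V \<alpha>" "continuous_on V \<alpha>'" "continuous_on V \<alpha>''" "continuous_on V \<beta>"
    and "\<And>p. p \<in> V \<Longrightarrow> cos ((\<alpha>' p + \<alpha>'' p - \<alpha> p - \<beta> p) / 4) = 0"
    and "\<And>p. p \<in> V \<Longrightarrow> cos ((\<alpha>' p + \<alpha>'' p + \<alpha> p + \<beta> p) / 4) = 0"
  shows "reflected_on V \<alpha> \<alpha>' \<alpha>'' \<beta>"
proof -
  have "continuous_on V (\<lambda>p. (\<alpha>' p + \<alpha>'' p - \<alpha> p - \<beta> p) / 4 + pi / 2)"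
    using cont by (intro continuous_intros) auto
  then obtain n where n: "\<forall>p\<in>V. (\<alpha>' p + \<alpha>'' p - \<alpha> p - \<beta> p) / 4 + pi / 2 = of_int n * pi"
    using sin_zero_on_connected[OF V, of "\<lambda>p. (\<alpha>' p + \<alpha>'' p - \<alpha> p - \<beta> p) / 4 + pi / 2"] assms(6) by (force simp: sin_add)
  have "continuous_on V (\<lambda>p. (\<alpha>' p + \<alpha>'' p + \<alpha> p + \<beta> p) / 4 + pi / 2)"
    using cont by (intro continuous_intros) auto
  then obtain m where m: "\<forall>p\<in>V. (\<alpha>' p + \<alpha>'' p + \<alpha> p + \<beta> p) / 4 + pi / 2 = of_int m * pi"
    using sin_zero_on_connected[OF V, of "\<lambda>p. (\<alpha>' p + \<alpha>'' p + \<alpha> p + \<beta> p) / 4 + pi / 2"] assms(7) by (force simp: sin_add)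
  have "\<beta> p = 2 * pi * of_int (m - n) - \<alpha> p \<and> \<alpha>'' p = 2 * pi * of_int (m + n - 1) - \<alpha>' p" if "p \<in> V" for p
    using n[rule_format, OF that] m[rule_format, OF that] by (simp add: field_simps)
  then show ?thesis
    unfolding reflected_on_def
    by (intro exI[of _ "m - n"] exI[of _ "m + n - 1"]) auto
qed

section \<open>Existence of the fourth solution\<close>

lemma superposition_domain_trig:
  "superposition_domain 0 c U \<alpha>' \<alpha>'' = U"
proof -
  have "x \<in> range tan" for x :: real using tan_arctan[of x] by (metis rangeI)
  then show ?thesis by (auto simp: superposition_domain_def Tf_def)
qed

lemma open_superposition_domain:
  assumes "r \<in> {0, 1}" "open U" "continuous_on U \<alpha>'" "continuous_on U \<alpha>''"
  shows "open (superposition_domain r c U \<alpha>' \<alpha>'')"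
proof (cases "r = 0")
  case True
  then show ?thesis using assms(2) superposition_domain_trig by simp
next
  case False
  then have r: "(-1::int) ^ r = -1" using assms(1) by auto
  have "continuous_on U (\<lambda>p. c * tanh ((\<alpha>' p - \<alpha>'' p) / 4))"
  proof (intro continuous_on_mult continuous_on_const)
    have "continuous_on U (\<lambda>p. (\<alpha>' p - \<alpha>'' p) / 4)"
      using assms(3,4) by (intro continuous_on_divide continuous_on_diff continuous_on_const) auto
    then show "continuous_on U (\<lambda>p. tanh ((\<alpha>' p - \<alpha>'' p) / 4))"
      by (rule continuous_on_tanh) (simp add: less_imp_neq[OF cosh_real_pos, symmetric])
  qed
  then have "open (U \<inter> (\<lambda>p. c * tanh ((\<alpha>' p - \<alpha>'' p) / 4)) -` {-1<..<1})"
    using assms(2) by (rule continuous_open_preimage) (rule open_greaterThanLessThan)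
  also have "U \<inter> (\<lambda>p. c * tanh ((\<alpha>' p - \<alpha>'' p) / 4)) -` {-1<..<1}
      = superposition_domain r c U \<alpha>' \<alpha>''"
    by (auto simp: superposition_domain_def r Tf_def range_tanh)
  finally show ?thesis .
qed

text \<open>The second transformation equation follows from the first by exchanging \<open>\<alpha>'\<close> and \<open>\<alpha>''\<close>, which changes
  the signs of \<open>u\<close>, \<open>c\<close> and \<open>g\<close> and keeps \<open>Y\<close>.\<close>

lemma superposition_is_solution:
  assumes \<kappa>: "\<kappa> = 1 \<or> \<kappa> = -1"
    and ab: "a1 * b1 = \<xi>" "a2 * b2 = \<xi>" "\<xi> \<noteq> 0"
    and c: "c * (a2 - a1) = a1 + a2"
    and W: "open W" and C2: "C2_on W \<alpha>" "C2_on W \<alpha>'" "C2_on W \<alpha>''"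
    and wave: "\<And>p. p \<in> W \<Longrightarrow> pd1 (pd1 \<alpha>) p - pd2 (pd2 \<alpha>) p = \<xi> * Sf \<kappa> (\<alpha> p)"
    and bt: "\<And>p. p \<in> W \<Longrightarrow> bt_at \<kappa> a1 b1 \<alpha> \<alpha>' p" "\<And>p. p \<in> W \<Longrightarrow> bt_at \<kappa> a2 b2 \<alpha> \<alpha>'' p"
    and G: "\<And>p. p \<in> W \<Longrightarrow> (G has_real_derivative c / ((Cf \<kappa> ((\<alpha>' p - \<alpha>'' p) / 4))\<^sup>2
               + of_int \<kappa> * c\<^sup>2 * (Sf \<kappa> ((\<alpha>' p - \<alpha>'' p) / 4))\<^sup>2)) (at ((\<alpha>' p - \<alpha>'' p) / 4))"
      "\<And>p. p \<in> W \<Longrightarrow> Sf \<kappa> (G ((\<alpha>' p - \<alpha>'' p) / 4)) * Cf \<kappa> ((\<alpha>' p - \<alpha>'' p) / 4)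
          = c * Cf \<kappa> (G ((\<alpha>' p - \<alpha>'' p) / 4)) * Sf \<kappa> ((\<alpha>' p - \<alpha>'' p) / 4)"
      "\<And>p. p \<in> W \<Longrightarrow> (Cf \<kappa> ((\<alpha>' p - \<alpha>'' p) / 4))\<^sup>2
               + of_int \<kappa> * c\<^sup>2 * (Sf \<kappa> ((\<alpha>' p - \<alpha>'' p) / 4))\<^sup>2 > 0"
    and \<alpha>s: "\<alpha>s = (\<lambda>p. \<alpha> p + 4 * G ((\<alpha>' p - \<alpha>'' p) / 4))"
  shows "C2_on W \<alpha>s"
    and "\<And>p. p \<in> W \<Longrightarrow> pd1 (pd1 \<alpha>s) p - pd2 (pd2 \<alpha>s) p = \<xi> * Sf \<kappa> (\<alpha>s p)"
    and "\<And>p. p \<in> W \<Longrightarrow> bt_at \<kappa> a2 b2 \<alpha>' \<alpha>s p"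
    and "\<And>p. p \<in> W \<Longrightarrow> bt_at \<kappa> a1 b1 \<alpha>'' \<alpha>s p"
proof -
  define u where "u = (\<lambda>p. (1/4) * (\<alpha>' p - \<alpha>'' p))"
  define N where "N = (\<lambda>x. (Cf \<kappa> x)\<^sup>2 + of_int \<kappa> * c\<^sup>2 * (Sf \<kappa> x)\<^sup>2)"
  have u: "u p = (\<alpha>' p - \<alpha>'' p) / 4" for p by (simp add: u_def)
  note G' = G[folded u, folded N_def[THEN fun_cong]]
  note C1 = C2[THEN C2_on_imp_C1_on(1)]
  have C1u: "C1_on W u" unfolding u_def by (intro C1_on_cmult C1_on_diff C1)
  have C1G: "C1_on W (\<lambda>p. G (u p))"
  proof (rule C1_on_chain[OF C1u G'(1)])
    show "continuous_on (u ` W) (\<lambda>x. c / N x)"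
      unfolding N_def
      by (intro continuous_on_divide continuous_on_add continuous_on_mult continuous_on_power
          continuous_on_const continuous_on_Cf[OF \<kappa>] continuous_on_Sf continuous_on_id)
        (use G'(3) in \<open>force simp: N_def\<close>)
  qed
  have as: "\<alpha>s = (\<lambda>p. \<alpha> p + 4 * G (u p))" by (simp add: \<alpha>s u)
  have C1s: "C1_on W \<alpha>s" unfolding as by (intro C1_on_add C1_on_cmult C1 C1G)
  have pd: "pd1 \<alpha>s p = pd1 \<alpha> p + c / N (u p) * (pd1 \<alpha>' p - pd1 \<alpha>'' p)"
       "pd2 \<alpha>s p = pd2 \<alpha> p + c / N (u p) * (pd2 \<alpha>' p - pd2 \<alpha>'' p)" if p: "p \<in> W" for p
  proof -
    note g = C1[THEN C1_on_imp_has_grad, OF p]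
    have "has_grad u ((1/4) * (pd1 \<alpha>' p - pd1 \<alpha>'' p)) ((1/4) * (pd2 \<alpha>' p - pd2 \<alpha>'' p)) p"
      unfolding u_def by (intro has_grad_cmult has_grad_diff g)
    from has_grad_chain[OF this G'(1)[OF p]]
    have "has_grad \<alpha>s (pd1 \<alpha> p + 4 * (c / N (u p) * ((1/4) * (pd1 \<alpha>' p - pd1 \<alpha>'' p))))
        (pd2 \<alpha> p + 4 * (c / N (u p) * ((1/4) * (pd2 \<alpha>' p - pd2 \<alpha>'' p)))) p"
      unfolding as by (intro has_grad_add has_grad_cmult g)
    from has_grad_imp_pd[OF this]
    show "pd1 \<alpha>s p = pd1 \<alpha> p + c / N (u p) * (pd1 \<alpha>' p - pd1 \<alpha>'' p)"
      "pd2 \<alpha>s p = pd2 \<alpha> p + c / N (u p) * (pd2 \<alpha>' p - pd2 \<alpha>'' p)" by simp_all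
  qed
  show bts: "bt_at \<kappa> a2 b2 \<alpha>' \<alpha>s p" if p: "p \<in> W" for p
  proof (rule superposition_bt_at[OF \<kappa> ab c bt(1)[OF p] bt(2)[OF p] u _ G'(2)[OF p]
        _ _ _ pd[OF p]])
    show "\<alpha>s p = \<alpha> p + 4 * G (u p)" by (simp add: as)
    show "N (u p) = (Cf \<kappa> (u p))\<^sup>2 + of_int \<kappa> * c\<^sup>2 * (Sf \<kappa> (u p))\<^sup>2"
      by (simp add: N_def)
    show "N (u p) \<noteq> 0" "c / N (u p) * N (u p) = c" using G'(3)[OF p] by simp_all
  qed
  show "bt_at \<kappa> a1 b1 \<alpha>'' \<alpha>s p" if p: "p \<in> W" for p
  proof (rule superposition_bt_at[OF \<kappa> ab(2,1,3) _ bt(2)[OF p] bt(1)[OF p],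
        where c = "- c" and u = "- u p" and Y = "G (u p)" and N = "N (u p)" and g = "- (c / N (u p))"])
    show "- c * (a1 - a2) = a2 + a1" using c by (simp add: algebra_simps)
    show "Sf \<kappa> (G (u p)) * Cf \<kappa> (- u p) = - c * Cf \<kappa> (G (u p)) * Sf \<kappa> (- u p)"
      using G'(2)[OF p] by simp
    show "pd1 \<alpha>s p = pd1 \<alpha> p + - (c / N (u p)) * (pd1 \<alpha>'' p - pd1 \<alpha>' p)"
      "pd2 \<alpha>s p = pd2 \<alpha> p + - (c / N (u p)) * (pd2 \<alpha>'' p - pd2 \<alpha>' p)"
      unfolding pd[OF p] by (simp_all add: algebra_simps)
    show "- u p = (\<alpha>'' p - \<alpha>' p) / 4" by (simp add: u minus_divide_left)
    show "\<alpha>s p = \<alpha> p + 4 * G (u p)" by (simp add: as)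
    show "N (u p) = (Cf \<kappa> (- u p))\<^sup>2 + of_int \<kappa> * (- c)\<^sup>2 * (Sf \<kappa> (- u p))\<^sup>2"
      by (simp add: N_def)
    show "N (u p) \<noteq> 0" "- (c / N (u p)) * N (u p) = - c" using G'(3)[OF p] by simp_all
  qed
  show C2s: "C2_on W \<alpha>s" by (rule bt_at_C2_on[OF W C2(2) C1s \<kappa> bts])
  show "pd1 (pd1 \<alpha>s) p - pd2 (pd2 \<alpha>s) p = \<xi> * Sf \<kappa> (\<alpha>s p)" if p: "p \<in> W" for p
  proof -
    \<comment> \<open>The wave equation for \<open>\<alpha>\<close>, compared with the one that its link to \<open>\<alpha>'\<close> gives, kills the commutator.\<close>
    have "pd1 (pd1 \<alpha>) p - pd2 (pd2 \<alpha>) p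
        = (- a1) * (- b1) * Sf \<kappa> (\<alpha> p) - (pd1 (pd2 \<alpha>') p - pd2 (pd1 \<alpha>') p)"
      using bt(1) by (intro wave_commutator[OF \<kappa> W p C2(2) C2(1)]) (simp flip: bt_at_sym)
    then have "pd1 (pd2 \<alpha>') p - pd2 (pd1 \<alpha>') p = 0" using wave[OF p] ab by simp
    then show ?thesis
      using wave_commutator[OF \<kappa> W p C2(2) C2s bts] ab by simp
  qed
qed

lemma sinh_proportional_imp_tanh:
  assumes "sinh y * cosh x = c * cosh y * sinh (x::real)"
  shows "tanh y = c * tanh x"
  using assms by (simp add: tanh_def field_simps)

text \<open>For \<open>r = 0\<close> the equation without denominators also records that \<open>cos y\<close> and \<open>cos x\<close> vanish together.\<close>

lemma superposition_formula_of_proportional: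
  assumes "r \<in> {0, 1}" "c \<noteq> 0"
    and "\<And>p. p \<in> W \<Longrightarrow> Sf ((-1) ^ r) ((\<alpha>s p - \<alpha> p) / 4) * Cf ((-1) ^ r) ((\<alpha>' p - \<alpha>'' p) / 4)
        = c * Cf ((-1) ^ r) ((\<alpha>s p - \<alpha> p) / 4) * Sf ((-1) ^ r) ((\<alpha>' p - \<alpha>'' p) / 4)"
  shows "superposition_formula r c W \<alpha> \<alpha>' \<alpha>'' \<alpha>s"
proof (cases "r = 0")
  case True
  have "tan y = c * tan x \<and> (cos y = 0 \<longleftrightarrow> cos x = 0)"
    if "sin y * cos x = c * cos y * sin x" for x y
  proof -
    have "cos y = 0 \<longleftrightarrow> cos x = 0"
      using that assms(2) sin_zero_abs_cos_one[of x] sin_zero_abs_cos_one[of y] by auto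
    then show ?thesis
      using that by (cases "cos x = 0") (simp_all add: tan_def field_simps)
  qed
  then show ?thesis
    using assms(3) True by (simp add: superposition_formula_def Sf_def Cf_def Tf_def)
next
  case False
  then show ?thesis
    using assms(1,3) sinh_proportional_imp_tanh
    by (simp add: superposition_formula_def Sf_def Cf_def Tf_def)
qed

section \<open>Uniqueness of the fourth solution\<close>

lemma proportional_if_defect_zero:
  assumes \<kappa>: "\<kappa> = 1 \<or> \<kappa> = -1"
    and "c * (a2 - a1) = a1 + a2" "a1 \<noteq> a2" "a1 * Sf \<kappa> (Y + u) = a2 * Sf \<kappa> (Y - u)"
  shows "Sf \<kappa> Y * Cf \<kappa> u = c * Cf \<kappa> Y * Sf \<kappa> u"
proof -
  have "(a2 - a1) * (Sf \<kappa> Y * Cf \<kappa> u) = (a1 + a2) * Cf \<kappa> Y * Sf \<kappa> u"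
    using assms(4) unfolding Sf_plus[OF \<kappa>] Sf_diff[OF \<kappa>] by (simp add: algebra_simps)
  then have "(a2 - a1) * (Sf \<kappa> Y * Cf \<kappa> u - c * Cf \<kappa> Y * Sf \<kappa> u) = 0"
    unfolding assms(2)[symmetric] by (simp add: algebra_simps)
  then show ?thesis using assms(3) by simp
qed

lemma superposition_proportional_or_reflected:
  assumes \<kappa>: "\<kappa> = 1 \<or> \<kappa> = -1"
    and ab: "a1 * b1 = \<xi>" "a2 * b2 = \<xi>" "\<xi> \<noteq> 0" and c: "c * (a2 - a1) = a1 + a2"
    and V: "open V" "connected V"
    and C1: "C1_on V \<alpha>" "C1_on V \<alpha>'" "C1_on V \<alpha>''" "C1_on V \<beta>"
    and bt: "\<And>q. q \<in> V \<Longrightarrow> bt_at \<kappa> a1 b1 \<alpha> \<alpha>' q" "\<And>q. q \<in> V \<Longrightarrow> bt_at \<kappa> a2 b2 \<alpha> \<alpha>'' q"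
      "\<And>q. q \<in> V \<Longrightarrow> bt_at \<kappa> a2 b2 \<alpha>' \<beta> q" "\<And>q. q \<in> V \<Longrightarrow> bt_at \<kappa> a1 b1 \<alpha>'' \<beta> q"
  shows "(\<forall>p\<in>V. Sf \<kappa> ((\<beta> p - \<alpha> p) / 4) * Cf \<kappa> ((\<alpha>' p - \<alpha>'' p) / 4)
               = c * Cf \<kappa> ((\<beta> p - \<alpha> p) / 4) * Sf \<kappa> ((\<alpha>' p - \<alpha>'' p) / 4))
       \<or> \<kappa> = 1 \<and> reflected_on V \<alpha> \<alpha>' \<alpha>'' \<beta>"
proof -
  have "a1 \<noteq> a2" using ab c by auto
  consider (defect) "\<forall>p\<in>V. a1 * Sf \<kappa> ((\<beta> p - \<alpha> p + \<alpha>' p - \<alpha>'' p) / 4)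
                = a2 * Sf \<kappa> ((\<beta> p - \<alpha> p - \<alpha>' p + \<alpha>'' p) / 4)"
    | (cosines) "\<forall>p\<in>V. Cf \<kappa> ((\<alpha>' p + \<alpha>'' p - \<alpha> p - \<beta> p) / 4) = 0 \<and>
           Cf \<kappa> ((\<alpha>' p + \<alpha>'' p + \<alpha> p + \<beta> p) / 4) = 0"
    using quadrilateral_dichotomy[OF \<kappa> ab V C1 bt] by blast
  then show ?thesis
  proof cases
    case defect
    have "Sf \<kappa> ((\<beta> p - \<alpha> p) / 4) * Cf \<kappa> ((\<alpha>' p - \<alpha>'' p) / 4)
               = c * Cf \<kappa> ((\<beta> p - \<alpha> p) / 4) * Sf \<kappa> ((\<alpha>' p - \<alpha>'' p) / 4)" if "p \<in> V" for p
    proof (rule proportional_if_defect_zero[OF \<kappa> c \<open>a1 \<noteq> a2\<close>])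
      have "(\<beta> p - \<alpha> p) / 4 + (\<alpha>' p - \<alpha>'' p) / 4 = (\<beta> p - \<alpha> p + \<alpha>' p - \<alpha>'' p) / 4"
        "(\<beta> p - \<alpha> p) / 4 - (\<alpha>' p - \<alpha>'' p) / 4 = (\<beta> p - \<alpha> p - \<alpha>' p + \<alpha>'' p) / 4"
        by (simp_all add: field_simps)
      then show "a1 * Sf \<kappa> ((\<beta> p - \<alpha> p) / 4 + (\<alpha>' p - \<alpha>'' p) / 4)
          = a2 * Sf \<kappa> ((\<beta> p - \<alpha> p) / 4 - (\<alpha>' p - \<alpha>'' p) / 4)"
        using defect[rule_format, OF that] by (simp only:)
    qed
    then show ?thesis by blast
  next
    case cosines
    show ?thesis
    proof (cases "V = {} \<or> \<kappa> = 1")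
      case True
      then show ?thesis
        using cosines reflected_on_of_cos_zero[OF V(2) C1[THEN C1_on_imp_continuous_on]]
        by (auto simp: Cf_def)
    next
      case False
      then obtain p where "p \<in> V" by blast
      then have "cosh ((\<alpha>' p + \<alpha>'' p - \<alpha> p - \<beta> p) / 4) = 0"
        using False cosines[rule_format, OF \<open>p \<in> V\<close>] by (simp add: Cf_def)
      then show ?thesis by (simp add: less_imp_neq[OF cosh_real_pos, symmetric])
    qed
  qed
qed

text \<open>Both \<open>(cos y, sin y)\<close> and \<open>(cos z, sin z)\<close> are proportional to the nonzero vector \<open>(cos x, c * sin x)\<close>.\<close>

lemma sin_diff_zero_of_proportional:
  fixes c :: real
  assumes "c \<noteq> 0" "sin y * cos x = c * cos y * sin x" "sin z * cos x = c * cos z * sin x"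
  shows "sin (y - z) = 0"
proof (cases "cos x = 0")
  case True
  then have "sin x \<noteq> 0" using sin_cos_squared_add[of x] by auto
  then show ?thesis using True assms by (simp add: sin_diff)
next
  case False
  have "cos x * sin (y - z) = (sin y * cos x) * cos z - cos y * (sin z * cos x)"
    by (simp add: sin_diff algebra_simps)
  also have "\<dots> = 0" unfolding assms(2,3) by simp
  finally show ?thesis using False by simp
qed

theorem theorem3p1:
  fixes \<delta> \<epsilon> \<tau> :: int and r s :: nat and \<phi>1 \<phi>2 :: real
    and U :: "(real \<times> real) set" and \<alpha> \<alpha>' \<alpha>'' :: "real \<times> real \<Rightarrow> real"
  assumes "\<delta> \<in> {1, -1}" and "\<epsilon> \<in> {1, -1}" and "\<tau> \<in> {1, -1}"
    and "r \<in> {0, 1}" and "s \<in> {0, 1}" and "r \<le> s"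
    and "\<delta> = (-1) ^ (s + 1)" and "\<delta> = -1 \<longrightarrow> \<epsilon> = 1"
    and "\<phi>1 \<in> parameter_range \<epsilon> s" and "\<phi>2 \<in> parameter_range \<epsilon> s" and "\<phi>1 \<noteq> \<phi>2"
    and "open U"
    and "solution_on \<delta> \<epsilon> r U \<alpha>" and "solution_on \<delta> \<epsilon> r U \<alpha>'" and "solution_on \<delta> \<epsilon> r U \<alpha>''"
    and "backlund \<delta> \<epsilon> \<tau> r s \<phi>1 U \<alpha> \<alpha>'"
    and "backlund \<delta> \<epsilon> \<tau> r s \<phi>2 U \<alpha> \<alpha>''"
  defines "c \<equiv> superposition_coeff \<delta> \<epsilon> \<tau> \<phi>1 \<phi>2"
  defines "W \<equiv> superposition_domain r c U \<alpha>' \<alpha>''"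
  shows "\<exists>\<alpha>s.
      open W \<and> (r = 0 \<longrightarrow> W = U) \<and>
      solution_on \<delta> \<epsilon> r W \<alpha>s \<and>
      backlund \<delta> \<epsilon> \<tau> r s \<phi>2 W \<alpha>' \<alpha>s \<and>
      backlund \<delta> \<epsilon> \<tau> r s \<phi>1 W \<alpha>'' \<alpha>s \<and>
      superposition_formula r c W \<alpha> \<alpha>' \<alpha>'' \<alpha>s \<and>
      (\<forall>V \<beta>. open V \<and> connected V \<and> V \<subseteq> U \<and>
         solution_on \<delta> \<epsilon> r V \<beta> \<and>
         backlund \<delta> \<epsilon> \<tau> r s \<phi>2 V \<alpha>' \<beta> \<and>
         backlund \<delta> \<epsilon> \<tau> r s \<phi>1 V \<alpha>'' \<beta> \<longrightarrow>
           V \<subseteq> W \<and>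
           (equal_up_to_period r V \<beta> \<alpha>s \<or> r = 0 \<and> reflected_on V \<alpha> \<alpha>' \<alpha>'' \<beta>))"
proof -
  define \<kappa> :: int where "\<kappa> = (-1) ^ r"
  define X where "X = - \<epsilon> * \<delta>"
  define \<sigma> where "\<sigma> = \<delta> * \<tau>"
  define a1 where "a1 = bt_speed X (of_int \<sigma>) \<phi>1"
  define a2 where "a2 = bt_speed X (of_int \<sigma>) \<phi>2"
  define b1 where "b1 = bt_speed X (- of_int \<sigma>) \<phi>1"
  define b2 where "b2 = bt_speed X (- of_int \<sigma>) \<phi>2"
  have \<kappa>: "\<kappa> = 1 \<or> \<kappa> = -1" and \<kappa>r: "\<kappa> = 1 \<longleftrightarrow> r = 0"
    using assms(4) by (auto simp: \<kappa>_def)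
  have X: "X = 1 \<or> X = -1" and \<sigma>: "\<sigma> = 1 \<or> \<sigma> = -1"
    using assms(1-3) by (auto simp: X_def \<sigma>_def)
  have Xs: "X = \<epsilon> * (-1) ^ s" using assms(5,7) by (auto simp: X_def)
  note \<phi>1 = parameter_range_bounds[OF assms(9) Xs] and \<phi>2 = parameter_range_bounds[OF assms(10) Xs]
  have half: "Sf X (\<phi>1/2) > 0" "Cf X (\<phi>1/2) > 0" "Sf X (\<phi>2/2) > 0" "Cf X (\<phi>2/2) > 0"
    using \<phi>1 \<phi>2 by (auto intro!: Sf_pos Cf_pos)
  have full: "Sf X \<phi>1 > 0" "Sf X \<phi>2 > 0" using \<phi>1 \<phi>2 by (auto intro!: Sf_pos)
  have diff: "Sf X ((\<phi>2 - \<phi>1) / 2) \<noteq> 0"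
    using \<phi>1(1) \<phi>2(1) \<phi>1(2) \<phi>2(2) assms(11) by (rule Sf_half_diff_nonzero)
  have sum: "Sf X ((\<phi>2 + \<phi>1) / 2) > 0"
  proof (rule Sf_pos)
    show "(\<phi>2 + \<phi>1) / 2 < pi" if "X = 1" using \<phi>1(2)[OF that] \<phi>2(2)[OF that] by simp
  qed (use \<phi>1(1) \<phi>2(1) in simp)
  have c: "c * (a2 - a1) = a1 + a2"
    unfolding c_def a1_def a2_def
    by (rule superposition_coeff_eq[OF X_def X \<sigma>_def \<sigma> _ _ _ _ diff]) (use half in simp_all)
  have c0: "c \<noteq> 0"
  proof -
    have "- \<delta> * \<epsilon> = X" by (simp add: X_def)
    then show ?thesis
      using assms(1,3) sum diff by (auto simp: c_def superposition_coeff_def)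
  qed
  have "(real_of_int \<sigma>)\<^sup>2 = 1" using \<sigma> by auto
  then have ab: "a1 * b1 = of_int X" "a2 * b2 = of_int X" "real_of_int X \<noteq> 0"
    using bt_speed_mult[OF X, of _ "of_int \<sigma>"] full X by (auto simp: a1_def a2_def b1_def b2_def)
  have bt_iff: "backlund \<delta> \<epsilon> \<tau> r s \<phi>1 V \<beta> \<beta>' \<longleftrightarrow> (\<forall>p\<in>V. bt_at \<kappa> a1 b1 \<beta> \<beta>' p)"
    "backlund \<delta> \<epsilon> \<tau> r s \<phi>2 V \<beta> \<beta>' \<longleftrightarrow> (\<forall>p\<in>V. bt_at \<kappa> a2 b2 \<beta> \<beta>' p)" for V \<beta> \<beta>'
    unfolding a1_def a2_def b1_def b2_def X_def \<sigma>_def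
    by (rule backlund_iff_bt_at[OF assms(7,5) \<kappa> \<kappa>_def])+
  note sol_iff = solution_on_iff[of \<delta> \<epsilon> r, folded \<kappa>_def X_def]
  have C2: "C2_on U \<alpha>" "C2_on U \<alpha>'" "C2_on U \<alpha>''"
    and wave: "\<And>p. p \<in> U \<Longrightarrow> pd1 (pd1 \<alpha>) p - pd2 (pd2 \<alpha>) p = of_int X * Sf \<kappa> (\<alpha> p)"
    using assms(13-15) unfolding sol_iff by auto
  have bt: "\<And>p. p \<in> U \<Longrightarrow> bt_at \<kappa> a1 b1 \<alpha> \<alpha>' p" "\<And>p. p \<in> U \<Longrightarrow> bt_at \<kappa> a2 b2 \<alpha> \<alpha>'' p"
    using assms(16,17) unfolding bt_iff by auto
  note C1 = C2[THEN C2_on_imp_C1_on(1)]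
  have openW: "open W"
    unfolding W_def using assms(4,12) C1(2,3)[THEN C1_on_imp_continuous_on]
    by (rule open_superposition_domain)
  have WU: "W \<subseteq> U" by (auto simp: W_def superposition_domain_def)
  have W_trig: "W = U" if "r = 0"
    unfolding W_def that by (rule superposition_domain_trig)
  have W_iff: "p \<in> W \<longleftrightarrow> p \<in> U \<and> c * Tf \<kappa> ((\<alpha>' p - \<alpha>'' p) / 4) \<in> range (Tf \<kappa>)" for p
    by (simp add: W_def superposition_domain_def \<kappa>_def)
  obtain G where G: "\<And>x. c * Tf \<kappa> x \<in> range (Tf \<kappa>) \<Longrightarrow>
     (G has_real_derivative c / ((Cf \<kappa> x)\<^sup>2 + of_int \<kappa> * c\<^sup>2 * (Sf \<kappa> x)\<^sup>2)) (at x) \<and>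
     Sf \<kappa> (G x) * Cf \<kappa> x = c * Cf \<kappa> (G x) * Sf \<kappa> x \<and>
     (Cf \<kappa> x)\<^sup>2 + of_int \<kappa> * c\<^sup>2 * (Sf \<kappa> x)\<^sup>2 > 0"
    using superposition_lift[OF \<kappa> c0] by blast
  define \<alpha>s where "\<alpha>s = (\<lambda>p. \<alpha> p + 4 * G ((\<alpha>' p - \<alpha>'' p) / 4))"
  have Y: "(\<alpha>s p - \<alpha> p) / 4 = G ((\<alpha>' p - \<alpha>'' p) / 4)" for p by (simp add: \<alpha>s_def)
  have angle_star: "Sf \<kappa> ((\<alpha>s p - \<alpha> p) / 4) * Cf \<kappa> ((\<alpha>' p - \<alpha>'' p) / 4)
        = c * Cf \<kappa> ((\<alpha>s p - \<alpha> p) / 4) * Sf \<kappa> ((\<alpha>' p - \<alpha>'' p) / 4)" if "p \<in> W" for p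
    unfolding Y using G that W_iff by blast
  have GW: "(G has_real_derivative c / ((Cf \<kappa> ((\<alpha>' p - \<alpha>'' p) / 4))\<^sup>2
               + of_int \<kappa> * c\<^sup>2 * (Sf \<kappa> ((\<alpha>' p - \<alpha>'' p) / 4))\<^sup>2)) (at ((\<alpha>' p - \<alpha>'' p) / 4))"
      "Sf \<kappa> (G ((\<alpha>' p - \<alpha>'' p) / 4)) * Cf \<kappa> ((\<alpha>' p - \<alpha>'' p) / 4)
          = c * Cf \<kappa> (G ((\<alpha>' p - \<alpha>'' p) / 4)) * Sf \<kappa> ((\<alpha>' p - \<alpha>'' p) / 4)"
      "(Cf \<kappa> ((\<alpha>' p - \<alpha>'' p) / 4))\<^sup>2
               + of_int \<kappa> * c\<^sup>2 * (Sf \<kappa> ((\<alpha>' p - \<alpha>'' p) / 4))\<^sup>2 > 0" if "p \<in> W" for p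
    using G W_iff[of p] that by blast+
  have onW: "pd1 (pd1 \<alpha>) p - pd2 (pd2 \<alpha>) p = of_int X * Sf \<kappa> (\<alpha> p)"
      "bt_at \<kappa> a1 b1 \<alpha> \<alpha>' p" "bt_at \<kappa> a2 b2 \<alpha> \<alpha>'' p" if "p \<in> W" for p
    by (rule wave bt, rule subsetD[OF WU that])+
  note sol = superposition_is_solution[OF \<kappa> ab c openW C2[THEN C2_on_subset, OF WU] onW GW \<alpha>s_def]
  have onV: "bt_at \<kappa> a1 b1 \<alpha> \<alpha>' p" "bt_at \<kappa> a2 b2 \<alpha> \<alpha>'' p" if "p \<in> V" "V \<subseteq> U" for p V
    by (rule bt, rule subsetD[OF that(2,1)])+
  have uniq: "V \<subseteq> W \<and> (equal_up_to_period r V \<beta> \<alpha>s \<or> r = 0 \<and> reflected_on V \<alpha> \<alpha>' \<alpha>'' \<beta>)"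
    if V: "open V" "connected V" and VU: "V \<subseteq> U" and \<beta>: "C2_on V \<beta>"
      and bt\<beta>: "\<And>p. p \<in> V \<Longrightarrow> bt_at \<kappa> a2 b2 \<alpha>' \<beta> p" "\<And>p. p \<in> V \<Longrightarrow> bt_at \<kappa> a1 b1 \<alpha>'' \<beta> p"
    for V \<beta>
  proof -
    note C1V = C1[THEN C1_on_subset, OF VU] C2_on_imp_C1_on(1)[OF \<beta>]
    consider (proportional) "\<forall>p\<in>V. Sf \<kappa> ((\<beta> p - \<alpha> p) / 4) * Cf \<kappa> ((\<alpha>' p - \<alpha>'' p) / 4)
               = c * Cf \<kappa> ((\<beta> p - \<alpha> p) / 4) * Sf \<kappa> ((\<alpha>' p - \<alpha>'' p) / 4)"
      | (reflected) "\<kappa> = 1" "reflected_on V \<alpha> \<alpha>' \<alpha>'' \<beta>"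
      using superposition_proportional_or_reflected[OF \<kappa> ab c V C1V onV(1)[OF _ VU]
          onV(2)[OF _ VU] bt\<beta>] by blast
    then show ?thesis
    proof cases
      case reflected
      then show ?thesis using W_trig VU \<kappa>r by simp
    next
      case proportional
      show ?thesis
      proof (cases "r = 0")
        case True
        then have \<kappa>1: "\<kappa> = 1" using \<kappa>r by simp
        have VW: "V \<subseteq> W" using W_trig[OF True] VU by simp
        have "sin ((\<beta> p - \<alpha> p) / 4 - (\<alpha>s p - \<alpha> p) / 4) = 0" if "p \<in> V" for p
          by (rule sin_diff_zero_of_proportional[OF c0, where x = "(\<alpha>' p - \<alpha>'' p) / 4"])
            (use proportional[rule_format, OF that] angle_star[OF subsetD[OF VW that]]
              in \<open>simp_all add: \<kappa>1 Sf_def Cf_def\<close>)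
        then have "sin ((\<beta> p - \<alpha>s p) / 4) = 0" if "p \<in> V" for p
          using that by (simp add: diff_divide_distrib)
        moreover have "continuous_on V (\<lambda>p. (\<beta> p - \<alpha>s p) / 4)"
          using C1V(4) C1_on_subset[OF C2_on_imp_C1_on(1)[OF sol(1)] VW]
          by (intro continuous_on_divide continuous_on_diff continuous_on_const
              C1_on_imp_continuous_on) auto
        ultimately obtain n :: int where n: "\<forall>p\<in>V. (\<beta> p - \<alpha>s p) / 4 = of_int n * pi"
          using sin_zero_on_connected[OF V(2)] by blast
        have "\<beta> p = \<alpha>s p + 4 * pi * of_int n" if "p \<in> V" for p
          using n[rule_format, OF that] by (simp add: field_simps)
        then show ?thesis using VW True by (auto simp: equal_up_to_period_def)
      next
        case False
        then have \<kappa>1: "\<kappa> = -1" using \<kappa>r \<kappa> by simp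
        have t: "tanh ((\<beta> p - \<alpha> p) / 4) = c * tanh ((\<alpha>' p - \<alpha>'' p) / 4)" if "p \<in> V" for p
          using proportional that sinh_proportional_imp_tanh by (simp add: \<kappa>1 Sf_def Cf_def)
        have VW: "V \<subseteq> W"
        proof
          fix p assume p: "p \<in> V"
          have "c * Tf \<kappa> ((\<alpha>' p - \<alpha>'' p) / 4) = Tf \<kappa> ((\<beta> p - \<alpha> p) / 4)"
            using t[OF p] by (simp add: \<kappa>1 Tf_def)
          then show "p \<in> W" using VU p by (auto simp only: W_iff)
        qed
        have "\<beta> p = \<alpha>s p" if "p \<in> V" for p
        proof -
          have "tanh ((\<alpha>s p - \<alpha> p) / 4) = c * tanh ((\<alpha>' p - \<alpha>'' p) / 4)"
            using angle_star[of p] VW that sinh_proportional_imp_tanh by (auto simp: \<kappa>1 Sf_def Cf_def)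
          then have "(\<beta> p - \<alpha> p) / 4 = (\<alpha>s p - \<alpha> p) / 4" using t[OF that] by (metis tanh_real_eq_iff)
          then show ?thesis by simp
        qed
        then show ?thesis using VW False by (simp add: equal_up_to_period_def)
      qed
    qed
  qed
  show ?thesis
  proof (intro exI[of _ \<alpha>s] conjI allI impI)
    show "superposition_formula r c W \<alpha> \<alpha>' \<alpha>'' \<alpha>s"
      using assms(4) c0 angle_star unfolding \<kappa>_def by (rule superposition_formula_of_proportional)
    show "V \<subseteq> W" "equal_up_to_period r V \<beta> \<alpha>s \<or> r = 0 \<and> reflected_on V \<alpha> \<alpha>' \<alpha>'' \<beta>"
      if "open V \<and> connected V \<and> V \<subseteq> U \<and> solution_on \<delta> \<epsilon> r V \<beta> \<and>
         backlund \<delta> \<epsilon> \<tau> r s \<phi>2 V \<alpha>' \<beta> \<and> backlund \<delta> \<epsilon> \<tau> r s \<phi>1 V \<alpha>'' \<beta>" for V \<beta>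
      using uniq[of V \<beta>] that unfolding sol_iff bt_iff by blast+
    show "solution_on \<delta> \<epsilon> r W \<alpha>s" using sol(1,2) unfolding sol_iff by blast
    show "backlund \<delta> \<epsilon> \<tau> r s \<phi>2 W \<alpha>' \<alpha>s" "backlund \<delta> \<epsilon> \<tau> r s \<phi>1 W \<alpha>'' \<alpha>s"
      using sol(3,4) unfolding bt_iff by blast+
  qed (use openW W_trig in simp_all)
qed

end
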